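(* Consider the two-stage game described in the context with $m\ge2$ exchanges, in which each exchange proposes a first-price auction with a reserve price of its choice ($\mathrm{FP}_r$, $r\ge 0$). Then for every $r\ge0$, the profile in which every exchange proposes the first-price auction with the same reserve $r$ ($\mathrm{FP}_r$) is not a Nash equilibrium of the game between exchanges.
   Context: There are $n\ge 2$ bidders and $m$ exchanges (sellers). Bidder values $v_1,\dots,v_n\ge 0$ are drawn i.i.d. from a publicly known distribution $F$, which is differentiable on $[0,\infty)$, has no point mass, and has a continuous density $f$ that is positive on $(0,\infty)$. Exchange $j$ has market power $\lambda_j>0$, with $\sum_{j=1}^m\lambda_j=1$: a query comes from exchange $j$ with probability $\lambda_j$. For $r\ge0$, in $\mathrm{FP}_r$ the highest bidder wins the single item and pays his bid if his bid is at least $r$, and otherwise the item is not allocated; losers pay $0$; ties are broken uniformly at random. Two-stage game. Stage 1: the exchanges simultaneously propose auctions $\mathcal{M}_j=(\mathbf{x}^j,\mathbf{p}^j)$ from the allowed class. Stage 2: each bidder $i$ submits a bid depending only on his own value (the same bid regardless of which exchange the query comes from), so that bidders face the average mechanism $\sum_j\lambda_j\mathcal{M}_j$ with allocation $x_i(\mathbf{b})=\sum_j\lambda_j x_i^j(\mathbf{b})$ and payment $p_i(\mathbf{b})=\sum_j\lambda_j p^j_i(\mathbf{b})$. Bidder $i$'s utility is $x_i(\mathbf{b})v_i-p_i(\mathbf{b})$. The bidders play the symmetric Bayes-Nash equilibrium of the average mechanism: a common bidding function $\beta$ such that, for each bidder $i$, bidding $\beta(v_i)$ maximizes expected utility over the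 other bidders' values when the others use $\beta$. For this class the symmetric bidding equilibrium exists and is essentially unique, i.e. unique up to bids below the smallest reserve price and up to the bids at points of discontinuity of $\beta$. The payoff of exchange $j$ is its expected revenue $\mathrm{Rev}_j=\mathbb{E}_{\mathbf{v}}\big[\sum_i p^j_i(\beta(v_1),\dots,\beta(v_n))\big]$ (a finite number). A Nash equilibrium of the game between exchanges is a profile of allowed auctions such that no exchange can strictly increase its own expected revenue by unilaterally proposing another allowed auction. *)

theory Defs
  imports "HOL-Probability.Probability"
begin

text \<open>
  Bidders and exchanges are indexed by finite types \<open>'i\<close> and \<open>'j\<close>.
  A mechanism is a pair (allocation, payment); both components map a bid vector to one number per
  bidder.  Random tie-breaking is represented by winning probabilities and expected payments.
\<close>

type_synonym 'i mechanism =
  "(('i \<Rightarrow> real) \<Rightarrow> 'i \<Rightarrow> real) \<times> (('i \<Rightarrow> real) \<Rightarrow> 'i \<Rightarrow> real)"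

abbreviation alloc :: "'i mechanism \<Rightarrow> ('i \<Rightarrow> real) \<Rightarrow> 'i \<Rightarrow> real" where
  "alloc \<equiv> fst"

abbreviation pay :: "'i mechanism \<Rightarrow> ('i \<Rightarrow> real) \<Rightarrow> 'i \<Rightarrow> real" where
  "pay \<equiv> snd"

definition highest_bidders :: "('i::finite \<Rightarrow> real) \<Rightarrow> 'i set" where
  "highest_bidders b = {i. b i = Max (range b)}"

definition FP_alloc :: "real \<Rightarrow> ('i::finite \<Rightarrow> real) \<Rightarrow> 'i \<Rightarrow> real" where
  "FP_alloc r b i =
     (if i \<in> highest_bidders b \<and> r \<le> b i then 1 / real (card (highest_bidders b)) else 0)"

definition FP :: "real \<Rightarrow> 'i::finite mechanism" where
  "FP r = (FP_alloc r, \<lambda>b i. FP_alloc r b i * b i)"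

definition FP_class :: "'i::finite mechanism set" where
  "FP_class = {FP r | r. 0 \<le> r}"

definition average_mechanism ::
    "('j::finite \<Rightarrow> real) \<Rightarrow> ('j \<Rightarrow> 'i mechanism) \<Rightarrow> 'i mechanism" where
  "average_mechanism lam M =
     (\<lambda>b i. \<Sum>j\<in>UNIV. lam j * alloc (M j) b i, \<lambda>b i. \<Sum>j\<in>UNIV. lam j * pay (M j) b i)"

definition value_distribution :: "real measure \<Rightarrow> (real \<Rightarrow> real) \<Rightarrow> bool" where
  "value_distribution D f \<longleftrightarrow>
     prob_space D \<and>
     D = density lborel (\<lambda>x. ennreal (f x)) \<and>
     (\<forall>x<0. f x = 0) \<and>
     continuous_on {0..} f \<and>
     (\<forall>x>0. 0 < f x) \<and>
     cdf D differentiable_on {0..} \<and>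
     (\<forall>x. measure D {x} = 0)"

text \<open>
  The expectation is over the values of the bidders other than \<open>i\<close>, who all use \<open>\<beta>\<close>,
  while bidder \<open>i\<close> has value \<open>v\<close> and bids \<open>b\<close>.
\<close>

definition interim_utility ::
    "real measure \<Rightarrow> 'i::finite mechanism \<Rightarrow> (real \<Rightarrow> real) \<Rightarrow> 'i \<Rightarrow> real \<Rightarrow> real \<Rightarrow> real" where
  "interim_utility D M \<beta> i v b =
     (\<integral>w. (let c = (\<lambda>k. if k = i then b else \<beta> (w k)) in alloc M c i * v - pay M c i)
        \<partial>(\<Pi>\<^sub>M k\<in>UNIV - {i}. D))"

text \<open>Values and bids are nonnegative; only \<open>\<beta>\<close> on \<open>{0..}\<close> matters.\<close>

definition symmetric_BNE ::
    "real measure \<Rightarrow> 'i::finite mechanism \<Rightarrow> (real \<Rightarrow> real) \<Rightarrow> bool" where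
  "symmetric_BNE D M \<beta> \<longleftrightarrow>
     \<beta> \<in> borel_measurable borel \<and>
     (\<forall>v\<ge>0. 0 \<le> \<beta> v) \<and>
     (\<forall>i. \<forall>v\<ge>0. \<forall>b\<ge>0. interim_utility D M \<beta> i v b \<le> interim_utility D M \<beta> i v (\<beta> v))"

text \<open>
  The bidding equilibrium is unique only up to irrelevant bids, so the bidders' behaviour is
  an arbitrary selection \<open>\<sigma>\<close>, assigning to every profile of auctions in the class \<open>C\<close> one of the
  symmetric equilibria of the average mechanism.  The premise that an equilibrium exists keeps
  the predicate satisfiable without presupposing existence.
\<close>

definition bidding_selection ::
    "real measure \<Rightarrow> ('j::finite \<Rightarrow> real) \<Rightarrow> 'i::finite mechanism set
      \<Rightarrow> (('j \<Rightarrow> 'i mechanism) \<Rightarrow> real \<Rightarrow> real) \<Rightarrow> bool" where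
  "bidding_selection D lam C \<sigma> \<longleftrightarrow>
     (\<forall>M. (\<forall>j. M j \<in> C) \<longrightarrow> (\<exists>\<beta>. symmetric_BNE D (average_mechanism lam M) \<beta>) \<longrightarrow>
        symmetric_BNE D (average_mechanism lam M) (\<sigma> M))"

definition total_payment ::
    "'i::finite mechanism \<Rightarrow> (real \<Rightarrow> real) \<Rightarrow> ('i \<Rightarrow> real) \<Rightarrow> real" where
  "total_payment M \<beta> w = (\<Sum>i\<in>UNIV. pay M (\<lambda>k. \<beta> (w k)) i)"

definition Rev ::
    "real measure \<Rightarrow> (('j \<Rightarrow> 'i::finite mechanism) \<Rightarrow> real \<Rightarrow> real)
      \<Rightarrow> ('j \<Rightarrow> 'i mechanism) \<Rightarrow> 'j \<Rightarrow> real" where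
  "Rev D \<sigma> M j = (\<integral>w. total_payment (M j) (\<sigma> M) w \<partial>(\<Pi>\<^sub>M i\<in>UNIV. D))"

text \<open>Needed because the Bochner integral in \<open>Rev\<close> is \<open>0\<close> for a non-integrable payment.\<close>

definition finite_Rev ::
    "real measure \<Rightarrow> 'i::finite mechanism set
      \<Rightarrow> (('j \<Rightarrow> 'i mechanism) \<Rightarrow> real \<Rightarrow> real) \<Rightarrow> bool" where
  "finite_Rev D C \<sigma> \<longleftrightarrow>
     (\<forall>M j. (\<forall>k. M k \<in> C) \<longrightarrow>
        integrable (\<Pi>\<^sub>M i\<in>UNIV. D) (total_payment (M j) (\<sigma> M)))"

definition exchange_Nash ::
    "'a set \<Rightarrow> (('j \<Rightarrow> 'a) \<Rightarrow> 'j \<Rightarrow> real) \<Rightarrow> ('j \<Rightarrow> 'a) \<Rightarrow> bool" where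
  "exchange_Nash C payoff M \<longleftrightarrow>
     (\<forall>j. M j \<in> C) \<and> (\<forall>j. \<forall>M'\<in>C. payoff (M(j := M')) j \<le> payoff M j)"

end

(*
  Against any average of first-price auctions with two reserves a <= b, of weights alpha and
  1 - alpha, a symmetric equilibrium is pinned down by the envelope theorem: values below a
  bid below a, values between a and a threshold t bid below b and win with probability alpha * G,
  and values above t bid at least b and win with probability G = F^(n-1). Indifference of t reads
  (t - b) * G t = alpha * (integral of G over [a, t]), and the common reserve r is the degenerate
  case a = b = t = r. The revenue of each exchange is thus an explicit integral, whichever
  equilibrium is selected. If r > 0, lowering one reserve slightly gains to first order; if r = 0,
  raising one reserve so that t is small gains.
*)

theory Submission
  imports Defs
begin

text \<open>The selection \<open>\<sigma>\<close> constrains the bidders only where an equilibrium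
  exists, so the revenue formula has two halves: an explicit equilibrium for two reserves, and a
  proof that all symmetric equilibria yield the same payments for almost every value. The second
  half starts from an arbitrary measurable \<open>\<beta>\<close>: monotonicity, absence of ties and
  the form of the bids are all extracted from best responses. Ties are never computed exactly; three
  inequalities for the winning probability suffice. Utilities have kinks and bids may jump, so the
  envelope theorem is used in a form with finite differences only. The two deviations are
  constructed in opposite directions. When a reserve is lowered, \<open>a\<close> is chosen first
  and \<open>t\<close> comes from the intermediate value theorem; when one is raised,
  \<open>t\<close> is chosen first and \<open>b\<close> is read off the threshold equation. The case
  \<open>r = 0\<close> needs its own deviation because no lower reserve is allowed.\<close>

lemma small_step_mono:
  fixes h g :: "real \<Rightarrow> real"
  assumes "p \<le> q"
    and step: "\<And>u v. p \<le> u \<Longrightarrow> u \<le> v \<Longrightarrow> v \<le> q \<Longrightarrow> h u - (v - u) * (g v - g u) \<le> h v"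
  shows "h p \<le> h q"
proof -
  \<comment> \<open>Over \<open>Suc N\<close> equal steps the losses telescope to this fraction,
    which tends to 0.\<close>
  have bound: "h p - (q - p) * (g q - g p) / real (Suc N) \<le> h q" for N
  proof -
    define d where "d = (q - p) / real (Suc N)"
    define s where "s k = p + real k * d" for k
    have d: "0 \<le> d" using \<open>p \<le> q\<close> by (simp add: d_def)
    have s0: "s 0 = p" and sN: "s (Suc N) = q"
      by (simp_all add: s_def d_def field_simps)
    have sq: "s k \<le> q" if "k \<le> Suc N" for k
      unfolding sN[symmetric] using that d by (auto simp: s_def intro!: mult_right_mono)
    have "h p - d * (g (s k) - g p) \<le> h (s k)" if "k \<le> Suc N" for k
      using that
    proof (induction k)
      case 0
      then show ?case by (simp add: s0)
    next
      case (Suc k)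
      have diff: "s (Suc k) - s k = d" by (simp add: s_def algebra_simps)
      have "h (s k) - d * (g (s (Suc k)) - g (s k)) \<le> h (s (Suc k))"
        using step[of "s k" "s (Suc k)"] sq[of "Suc k"] Suc.prems d diff
        by (auto simp: s_def)
      with Suc show ?case by (simp add: algebra_simps)
    qed
    from this[of "Suc N"] show ?thesis by (simp add: sN d_def)
  qed
  have "(\<lambda>N. h p - (q - p) * (g q - g p) / real (Suc N)) \<longlonglongrightarrow> h p - 0"
    by (intro tendsto_intros LIMSEQ_Suc lim_const_over_n)
  then show ?thesis
    using LIMSEQ_le_const2[of _ "h p - 0"] bound by auto
qed

text \<open>An envelope theorem without derivatives: \<open>x\<close> bounds the slope of
  \<open>U\<close> from below and \<open>y\<close> that of \<open>V\<close> from above. The slopes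
  are compared only at distinct points, so they may jump at \<open>a\<close>, at \<open>t\<close> or
  at an end of the interval.\<close>

lemma envelope_compare:
  fixes U V x y :: "real \<Rightarrow> real"
  assumes "p \<le> q"
    and U: "\<And>u v. p \<le> u \<Longrightarrow> u \<le> v \<Longrightarrow> v \<le> q \<Longrightarrow> x u * (v - u) \<le> U v - U u"
    and V: "\<And>u v. p \<le> u \<Longrightarrow> u \<le> v \<Longrightarrow> v \<le> q \<Longrightarrow> V v - V u \<le> y v * (v - u)"
    and le: "\<And>u v. p \<le> u \<Longrightarrow> u < v \<Longrightarrow> v \<le> q \<Longrightarrow> y u \<le> x v"
  shows "V q - V p \<le> U q - U p"
proof -
  have "U p - V p \<le> U q - V q"
  \<comment> \<open>For \<open>U - V\<close> and this \<open>g\<close> the step condition reduces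
    exactly to \<open>y u \<le> x v\<close>.\<close>
  proof (rule small_step_mono[OF \<open>p \<le> q\<close>, where g = "\<lambda>v. x v + y v"])
    fix u v assume uv: "p \<le> u" "u \<le> v" "v \<le> q"
    show "U u - V u - (v - u) * (x v + y v - (x u + y u)) \<le> U v - V v"
    proof (cases "u = v")
      case False
      then have "(v - u) * y u \<le> (v - u) * x v"
        using le[of u v] uv by (intro mult_left_mono) auto
      then show ?thesis using U[OF uv] V[OF uv] by (simp add: algebra_simps)
    qed simp
  qed
  then show ?thesis by simp
qed

section \<open>The value distribution\<close>

text \<open>\<open>m\<close> counts the rivals of a bidder, so \<open>1 \<le> m\<close> stands for
  at least two bidders.\<close>

locale value_model =
  fixes D :: "real measure" and f :: "real \<Rightarrow> real" and m :: nat
  assumes value_distribution: "value_distribution D f" and m_pos: "1 \<le> m"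
begin

lemma D_density: "D = density lborel (\<lambda>x. ennreal (f x))"
  and f_neg: "x < 0 \<Longrightarrow> f x = 0"
  and f_cont: "continuous_on {0..} f"
  and f_pos: "0 < x \<Longrightarrow> 0 < f x"
  and D_atomless: "measure D {x} = 0"
  using value_distribution unfolding value_distribution_def by blast+

sublocale real_distribution D
proof -
  interpret prob_space D
    using value_distribution unfolding value_distribution_def by blast
  show "real_distribution D"
    by unfold_locales (simp_all add: D_density)
qed

definition F :: "real \<Rightarrow> real" where "F v = measure D {..v}"

text \<open>Distribution function of the highest rival value, hence the winning chance of type
  \<open>v\<close> when bids increase with the value; \<open>I\<close> below is the rent that goes
  with it.\<close>

definition G :: "real \<Rightarrow> real" where "G v = F v ^ m"

definition I :: "real \<Rightarrow> real" where "I v = integral {0..v} G"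

lemma F_cdf: "F = cdf D"
  by (auto simp: F_def cdf_def)

lemma F_mono: "u \<le> v \<Longrightarrow> F u \<le> F v"
  unfolding F_cdf by (rule cdf_nondecreasing)

lemma F_nonneg: "0 \<le> F v" and F_le_1: "F v \<le> 1"
  by (simp_all add: F_def)

lemma F_cont: "isCont F v"
  unfolding F_cdf isCont_cdf by (rule D_atomless)

lemma F_at_top: "(F \<longlongrightarrow> 1) at_top"
  unfolding F_cdf by (rule cdf_lim_at_top_prob)

lemma f_nonneg: "0 \<le> f x"
proof (cases "x = 0")
  case True
  have "(f \<longlongrightarrow> f 0) (at_right 0)"
    using f_cont by (auto simp: continuous_on_def intro: tendsto_within_subset)
  then have "0 \<le> f 0"
    by (rule tendsto_lowerbound) (auto simp: eventually_at_filter f_pos less_imp_le)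
  then show ?thesis using True by simp
next
  case False
  then show ?thesis using f_pos[of x] f_neg[of x] by (cases "x < 0") auto
qed

lemma f_measurable [measurable]: "f \<in> borel_measurable borel"
proof -
  have "(\<lambda>x. indicator {0..} x *\<^sub>R f x) \<in> borel_measurable borel"
    by (rule borel_measurable_continuous_on_indicator) (auto intro: f_cont)
  moreover have "(\<lambda>x. indicator {0..} x *\<^sub>R f x) = f"
  proof (rule ext)
    fix x show "indicator {0..} x *\<^sub>R f x = f x" by (cases "x < 0") (simp_all add: f_neg)
  qed
  ultimately show ?thesis by simp
qed

lemma AE_nonneg: "AE v in D. 0 \<le> v"
proof -
  have "AE x in lborel. 0 < ennreal (f x) \<longrightarrow> 0 \<le> x"
  proof (intro AE_I2 impI)
    fix x assume "0 < ennreal (f x)"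
    then show "0 \<le> x" using f_neg[of x] by (cases "x < 0") auto
  qed
  then show ?thesis
    unfolding D_density by (subst AE_density) auto
qed

lemma AE_neq: "AE v in D. v \<noteq> c"
proof -
  have "AE v in D. v \<notin> {c}"
    by (intro AE_not_in) (simp add: null_sets_def emeasure_eq_measure D_atomless)
  then show ?thesis by simp
qed

lemma F_diff: "u \<le> v \<Longrightarrow> F v - F u = measure D {u<..v}"
  using cdf_diff_eq[of u v] unfolding F_cdf by (cases "u = v") auto

lemma F_diff_ge:
  assumes "u \<le> v" "\<And>x. u < x \<Longrightarrow> x \<le> v \<Longrightarrow> c \<le> f x" "0 \<le> c"
  shows "c * (v - u) \<le> F v - F u"
proof -
  have "ennreal (c * (v - u)) = (\<integral>\<^sup>+x. ennreal c * indicator {u<..v} x \<partial>lborel)"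
    using assms by (simp add: nn_integral_cmult_indicator ennreal_mult)
  also have "\<dots> \<le> (\<integral>\<^sup>+x. ennreal (f x) * indicator {u<..v} x \<partial>lborel)"
    using assms by (intro nn_integral_mono) (auto simp: indicator_def ennreal_leI)
  also have "\<dots> = emeasure D {u<..v}"
    by (subst D_density) (simp add: emeasure_density)
  also have "\<dots> = ennreal (F v - F u)"
    using F_diff[OF \<open>u \<le> v\<close>] by (simp add: emeasure_eq_measure)
  finally show ?thesis
    using F_mono[OF \<open>u \<le> v\<close>] by (simp add: ennreal_le_iff)
qed

lemma F_strict_mono:
  assumes "0 \<le> u" "u < v"
  shows "F u < F v"
proof -
  \<comment> \<open>\<open>f\<close> may vanish at 0 and \<open>u\<close> may be 0: the right half
    of the interval stays away from 0.\<close>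
  define w where "w = (u + v) / 2"
  have w: "u < w" "w < v" using assms by (auto simp: w_def)
  have "continuous_on {w..v} f"
    using w assms by (intro continuous_on_subset[OF f_cont]) auto
  then obtain z where z: "z \<in> {w..v}" "\<And>x. x \<in> {w..v} \<Longrightarrow> f z \<le> f x"
    using continuous_attains_inf[of "{w..v}" f] w by auto
  have "f z * (v - w) \<le> F v - F w"
    using z w f_nonneg by (intro F_diff_ge) auto
  moreover have "0 < f z * (v - w)" using f_pos[of z] z w assms by auto
  ultimately show ?thesis using F_mono[of u w] w by linarith
qed

lemma F_pos: "0 < v \<Longrightarrow> 0 < F v"
  using F_strict_mono[of 0 v] F_nonneg[of 0] by linarith

lemma F_0: "F 0 = 0"
proof -
  have "AE v in D. \<not> v \<le> 0"
    using AE_nonneg AE_neq[of 0] by eventually_elim auto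
  then have "measure D {v \<in> space D. v \<le> 0} = 0"
    by (subst (asm) AE_iff_measurable[OF _ refl]) (auto simp: measure_def)
  then show ?thesis by (simp add: F_def atMost_def)
qed

lemma G_mono: "u \<le> v \<Longrightarrow> G u \<le> G v"
  unfolding G_def by (intro power_mono F_mono F_nonneg)

lemma G_nonneg: "0 \<le> G v" and G_le_1: "G v \<le> 1"
  by (simp_all add: G_def F_nonneg F_le_1 power_le_one)

lemma G_pos: "0 < v \<Longrightarrow> 0 < G v"
  by (simp add: G_def F_pos)

lemma G_strict_mono: "0 \<le> u \<Longrightarrow> u < v \<Longrightarrow> G u < G v"
  unfolding G_def using F_strict_mono F_nonneg m_pos by (intro power_strict_mono) auto

lemma G_0: "G 0 = 0"
  using m_pos by (simp add: G_def F_0)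

lemma G_cont: "isCont G v"
  unfolding G_def using F_cont by (intro continuous_intros) auto

lemma G_continuous_on: "continuous_on S G"
  using G_cont by (simp add: continuous_at_imp_continuous_on)

lemma I_diff: "0 \<le> u \<Longrightarrow> u \<le> v \<Longrightarrow> I v - I u = integral {u..v} G"
  unfolding I_def
  using Henstock_Kurzweil_Integration.integral_combine[of 0 u v G]
    integrable_continuous_real[OF G_continuous_on] by fastforce

lemma I_lower: "0 \<le> u \<Longrightarrow> u \<le> v \<Longrightarrow> G u * (v - u) \<le> I v - I u"
  and I_upper: "0 \<le> u \<Longrightarrow> u \<le> v \<Longrightarrow> I v - I u \<le> G v * (v - u)"
proof -
  assume uv: "0 \<le> u" "u \<le> v"
  have int: "G integrable_on {u..v}"
    by (rule integrable_continuous_real[OF G_continuous_on])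
  have "integral {u..v} (\<lambda>_. G u) \<le> integral {u..v} G"
    by (rule integral_le[OF _ int]) (auto simp: G_mono)
  then show "G u * (v - u) \<le> I v - I u" using uv by (simp add: I_diff mult.commute)
  have "integral {u..v} G \<le> integral {u..v} (\<lambda>_. G v)"
    by (rule integral_le[OF int]) (auto simp: G_mono)
  then show "I v - I u \<le> G v * (v - u)" using uv by (simp add: I_diff mult.commute)
qed

lemma I_neg: "v \<le> 0 \<Longrightarrow> I v = 0"
  unfolding I_def by (cases "v = 0") auto

lemma I_0: "I 0 = 0"
  by (simp add: I_neg)

lemma I_mono: "u \<le> v \<Longrightarrow> I u \<le> I v"
proof -
  have *: "I u \<le> I v" if "0 \<le> u" "u \<le> v" for u v
    using I_lower[OF that] mult_nonneg_nonneg[of "G u" "v - u"] G_nonneg[of u] that by linarith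
  show "u \<le> v \<Longrightarrow> I u \<le> I v"
    using *[of u v] *[of 0 v] I_neg[of u] I_neg[of v] I_0 by linarith
qed

lemma I_pos:
  assumes "0 < v"
  shows "0 < I v"
proof -
  have "0 < G (v/2) * (v - v/2)" using assms by (intro mult_pos_pos G_pos) auto
  then show ?thesis using I_lower[of "v/2" v] I_mono[of 0 "v/2"] assms by (simp add: I_0)
qed

lemma I_measurable [measurable]: "I \<in> borel_measurable borel"
  by (intro borel_measurable_mono monoI I_mono)

lemma G_measurable [measurable]: "G \<in> borel_measurable borel"
  by (intro borel_measurable_mono monoI G_mono)

lemma I_cont: "0 \<le> v \<Longrightarrow> continuous_on {0..v} I"
  unfolding I_def
  by (intro indefinite_integral_continuous_1 integrable_continuous_real G_continuous_on)

end

section \<open>Winning probabilities and expected payments\<close>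

text \<open>The factor of \<open>FP_alloc\<close> that does not involve the reserve and is therefore
  common to all exchanges.\<close>

definition tie_share :: "('i::finite \<Rightarrow> real) \<Rightarrow> 'i \<Rightarrow> real" where
  "tie_share c i = (if i \<in> highest_bidders c then 1 / real (card (highest_bidders c)) else 0)"

definition win :: "real measure \<Rightarrow> (real \<Rightarrow> real) \<Rightarrow> 'i::finite \<Rightarrow> real \<Rightarrow> real" where
  "win D \<beta> i y =
     (\<integral>w. tie_share (\<lambda>k. if k = i then y else \<beta> (w k)) i \<partial>(\<Pi>\<^sub>M k\<in>UNIV - {i}. D))"

lemma highest_bidders_iff: "i \<in> highest_bidders c \<longleftrightarrow> (\<forall>k. c k \<le> c i)"
  unfolding highest_bidders_def
  by (auto simp: eq_commute[of "c i"] Max_eq_iff)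

text \<open>Counting by a sum over all bidders makes the share visibly measurable in the
  bids.\<close>

lemma tie_share_eq:
  "tie_share c i = (if \<forall>k. c k \<le> c i then 1 / (\<Sum>k\<in>UNIV. if c k = c i then 1 else 0) else 0)"
proof (cases "\<forall>k. c k \<le> c i")
  case True
  then have "highest_bidders c = {k. c k = c i}"
    by (auto simp: set_eq_iff highest_bidders_iff intro: antisym)
  with True show ?thesis by (simp add: tie_share_def sum.If_cases)
next
  case False
  then show ?thesis unfolding tie_share_def highest_bidders_iff by (simp only: if_False)
qed

lemma tie_share_nonneg: "0 \<le> tie_share c i" and tie_share_le_1: "tie_share c i \<le> 1"
proof -
  show "0 \<le> tie_share c i" by (simp add: tie_share_def)
  have "1 \<le> card (highest_bidders c)" if "i \<in> highest_bidders c"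
    using that by (auto simp: Suc_le_eq card_gt_0_iff)
  then show "tie_share c i \<le> 1" by (auto simp: tie_share_def divide_le_eq)
qed

lemma tie_share_measurable:
  assumes "\<And>k. (\<lambda>w. c w k) \<in> borel_measurable M"
  shows "(\<lambda>w. tie_share (c w) i) \<in> borel_measurable M"
proof -
  note [measurable] = assms
  have "(\<lambda>w. if \<forall>k\<in>UNIV. c w k \<le> c w i
      then 1 / (\<Sum>k\<in>UNIV. if c w k = c w i then 1 else 0 :: real) else 0) \<in> borel_measurable M"
    by measurable
  then show ?thesis by (simp add: tie_share_eq[abs_def])
qed

lemma FP_alloc_eq: "FP_alloc \<rho> c i = of_bool (\<rho> \<le> c i) * tie_share c i"
  by (simp add: FP_alloc_def tie_share_def)

text \<open>The own bid \<open>y\<close> is fixed inside the integral, so the reserves contribute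
  only the total weight of the exchanges that accept \<open>y\<close>.\<close>

lemma interim_utility_average_FP:
  "interim_utility D (average_mechanism lam (\<lambda>j. FP (\<rho> j))) \<beta> i v y =
     (\<Sum>j\<in>UNIV. lam j * of_bool (\<rho> j \<le> y)) * win D \<beta> i y * (v - y)"
proof -
  define A where "A = (\<Sum>j\<in>UNIV. lam j * of_bool (\<rho> j \<le> y))"
  define s where "s w = tie_share (\<lambda>k. if k = i then y else \<beta> (w k)) i" for w
  have "(\<Sum>j\<in>UNIV. lam j * (of_bool (\<rho> j \<le> y) * s w)) * v
      - (\<Sum>j\<in>UNIV. lam j * (of_bool (\<rho> j \<le> y) * s w * y)) = A * (v - y) * s w" for w
    by (simp add: A_def mult.assoc[symmetric] sum_distrib_right[symmetric] del: sum_mult_of_bool_eq)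
       (simp add: algebra_simps)
  then have "interim_utility D (average_mechanism lam (\<lambda>j. FP (\<rho> j))) \<beta> i v y =
      (\<integral>w. A * (v - y) * s w \<partial>(\<Pi>\<^sub>M k\<in>UNIV - {i}. D))"
    by (simp add: interim_utility_def average_mechanism_def FP_def Let_def FP_alloc_eq s_def
        del: sum_mult_of_bool_eq)
  also have "\<dots> = A * (v - y) * win D \<beta> i y"
    by (simp add: win_def s_def)
  finally show ?thesis by (simp add: A_def mult_ac)
qed

context prob_space
begin

lemma measure_PiM_all:
  assumes "finite J" and [measurable]: "{x \<in> space M. Q x} \<in> sets M"
  shows "measure (\<Pi>\<^sub>M k\<in>J. M) {w \<in> space (\<Pi>\<^sub>M k\<in>J. M). \<forall>k\<in>J. Q (w k)} = prob {x \<in> space M. Q x} ^ card J"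
    and "{w \<in> space (\<Pi>\<^sub>M k\<in>J. M). \<forall>k\<in>J. Q (w k)} \<in> sets (\<Pi>\<^sub>M k\<in>J. M)"
proof -
  interpret P: product_prob_space "\<lambda>_. M" J by unfold_locales
  have eq: "{w \<in> space (\<Pi>\<^sub>M k\<in>J. M). \<forall>k\<in>J. Q (w k)} = (\<Pi>\<^sub>E k\<in>J. {x \<in> space M. Q x})"
    by (auto simp: space_PiM PiE_def Pi_def extensional_def)
  show "measure (\<Pi>\<^sub>M k\<in>J. M) {w \<in> space (\<Pi>\<^sub>M k\<in>J. M). \<forall>k\<in>J. Q (w k)} = prob {x \<in> space M. Q x} ^ card J"
    unfolding eq measure_def[of "\<Pi>\<^sub>M k\<in>J. M"] using assms
    by (simp add: P.emeasure_PiM emeasure_eq_measure ennreal_power)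
  show "{w \<in> space (\<Pi>\<^sub>M k\<in>J. M). \<forall>k\<in>J. Q (w k)} \<in> sets (\<Pi>\<^sub>M k\<in>J. M)"
    unfolding eq using assms by (intro sets_PiM_I_finite) auto
qed

end

locale bid_model = real_distribution D for D +
  fixes \<beta> :: "real \<Rightarrow> real" and m :: nat
  assumes bid_measurable [measurable]: "\<beta> \<in> borel_measurable borel"
begin

definition Hle where "Hle y = prob {x. \<beta> x \<le> y}"
definition Hlt where "Hlt y = prob {x. \<beta> x < y}"
definition Heq where "Heq y = prob {x. \<beta> x = y}"

text \<open>A bidder wins for certain when all rivals bid less, never when one bids more, gets
  \<open>1 / Suc m\<close> when all tie, and at least that share whenever nobody bids more. This
  replaces the binomial sum over the number of ties.\<close>

lemma win_bounds:
  fixes i :: "'i::finite"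
  assumes m: "CARD('i) = Suc m"
  shows "Hlt y ^ m \<le> win D \<beta> i y"
    and "win D \<beta> i y \<le> Hle y ^ m - (1 - 1 / real (Suc m)) * Heq y ^ m"
    and "Hle y ^ m / real (Suc m) \<le> win D \<beta> i y"
proof -
  define J where "J = UNIV - {i}"
  define P where "P = (\<Pi>\<^sub>M k\<in>J. D)"
  define s where "s w = tie_share (\<lambda>k. if k = i then y else \<beta> (w k)) i" for w
  interpret P: prob_space P unfolding P_def by (intro prob_space_PiM) unfold_locales
  have card_J: "card J = m" using m by (simp add: J_def card_Diff_singleton)
  have bid_k: "(\<lambda>w. if k = i then y else \<beta> (w k)) \<in> borel_measurable P" for k
  proof (cases "k = i")
    case False
    then have [measurable]: "(\<lambda>w. w k) \<in> measurable P D"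
      unfolding P_def by (intro measurable_component_singleton) (simp add: J_def)
    then have "(\<lambda>w. \<beta> (w k)) \<in> borel_measurable P"
      by (intro measurable_compose[OF _ bid_measurable]) (simp cong: measurable_cong_sets)
    then show ?thesis using False by simp
  qed simp
  have s_meas [measurable]: "s \<in> borel_measurable P"
    unfolding s_def by (intro tie_share_measurable bid_k)
  have s_int: "integrable P s"
    by (rule P.integrable_const_bound[where B = 1])
       (auto simp: s_def tie_share_nonneg tie_share_le_1)
  have win_s: "win D \<beta> i y = P.expectation s"
    by (simp add: win_def s_def[abs_def] P_def J_def)
  define E where "E Q = {w \<in> space P. \<forall>k\<in>J. Q (\<beta> (w k))}" for Q
  have E: "P.prob (E Q) = prob {x. Q (\<beta> x)} ^ m" "E Q \<in> P.events"
    if "{x \<in> space D. Q (\<beta> x)} \<in> events" for Q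
    using measure_PiM_all(1)[of J "\<lambda>x. Q (\<beta> x)"] that card_J
    by (simp add: E_def P_def, unfold E_def P_def, intro measure_PiM_all(2) that) simp
  have E_le: "P.prob (E (\<lambda>z. z \<le> y)) = Hle y ^ m" "E (\<lambda>z. z \<le> y) \<in> P.events"
    and E_lt: "P.prob (E (\<lambda>z. z < y)) = Hlt y ^ m" "E (\<lambda>z. z < y) \<in> P.events"
    and E_eq: "P.prob (E (\<lambda>z. z = y)) = Heq y ^ m" "E (\<lambda>z. z = y) \<in> P.events"
    by (subst E; simp add: Hle_def Hlt_def Heq_def)+
  have all_k: "(\<forall>k. (if k = i then y else \<beta> (w k)) \<le> (if i = i then y else \<beta> (w i)))
      \<longleftrightarrow> (\<forall>k\<in>J. \<beta> (w k) \<le> y)" for w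
    by (auto simp: J_def)
  define N where "N w = (\<Sum>k\<in>UNIV. if (if k = i then y else \<beta> (w k)) = y then 1 else 0 :: real)" for w
  have s_eq: "s w = (if \<forall>k\<in>J. \<beta> (w k) \<le> y then 1 / N w else 0)" for w
    unfolding s_def tie_share_eq all_k N_def by simp
  have N_split: "N w = 1 + (\<Sum>k\<in>J. if \<beta> (w k) = y then 1 else 0)" for w
    unfolding N_def J_def by (subst sum.remove[of _ i]) (auto intro!: sum.cong)
  have ind_int: "integrable P (indicator S :: _ \<Rightarrow> real)" if "S \<in> P.events" for S
    using that by (simp add: P.emeasure_eq_measure)
  have N_nonneg: "0 \<le> N w" for w by (simp add: N_split sum_nonneg add_nonneg_nonneg)
  have N_ge: "1 \<le> N w" for w by (simp add: N_split sum_nonneg)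
  have N_pos: "0 < N w" for w using N_ge[of w] by linarith
  have N_inv: "1 / N w \<le> 1" for w using N_ge[of w] by (simp add: divide_le_eq)
  have N_le: "N w \<le> real (Suc m)" for w
  proof -
    have "(\<Sum>k\<in>J. if \<beta> (w k) = y then 1 else 0 :: real) \<le> (\<Sum>k\<in>J. 1)"
      by (intro sum_mono) auto
    then show ?thesis by (simp add: N_split card_J)
  qed
  have N_lt: "N w = 1" if "\<forall>k\<in>J. \<beta> (w k) < y" for w
    using that by (auto simp: N_split intro!: sum.neutral)
  have N_eq: "N w = real (Suc m)" if "\<forall>k\<in>J. \<beta> (w k) = y" for w
    using that by (simp add: N_split card_J)
  have "P.expectation (indicator (E (\<lambda>z. z < y))) \<le> P.expectation s"
    using N_lt N_nonneg
    by (intro integral_mono s_int ind_int E_lt) (auto simp: indicator_def E_def s_eq less_imp_le)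
  then show "Hlt y ^ m \<le> win D \<beta> i y" using E_lt by (simp add: win_s)
  have "P.expectation s \<le> P.expectation (\<lambda>w. indicator (E (\<lambda>z. z \<le> y)) w
      - (1 - 1 / real (Suc m)) * indicator (E (\<lambda>z. z = y)) w)"
    using N_inv N_eq
    by (intro integral_mono s_int Bochner_Integration.integrable_diff integrable_mult_right ind_int E_le E_eq)
       (auto simp: indicator_def E_def s_eq)
  then show "win D \<beta> i y \<le> Hle y ^ m - (1 - 1 / real (Suc m)) * Heq y ^ m"
    using E_le E_eq
    by (simp add: win_s Bochner_Integration.integral_diff[OF ind_int integrable_mult_right[OF ind_int]])
  have "P.expectation (\<lambda>w. indicator (E (\<lambda>z. z \<le> y)) w / real (Suc m)) \<le> P.expectation s"
    using N_le N_ge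
    by (intro integral_mono s_int integrable_divide ind_int E_le)
       (auto simp: indicator_def E_def s_eq intro!: divide_left_mono mult_pos_pos N_pos)
  then show "Hle y ^ m / real (Suc m) \<le> win D \<beta> i y" using E_le by (simp add: win_s)
qed

text \<open>For \<open>y < y'\<close> the value \<open>W y\<close> lies below
  \<open>Hle y ^ m\<close> and \<open>W y'\<close> above \<open>Hlt y' ^ m\<close>, and
  \<open>Hle y \<le> Hlt y'\<close>.\<close>

lemma mono_of_H_bounds:
  assumes "\<And>y. Hlt y ^ m \<le> W y" "\<And>y. W y \<le> Hle y ^ m"
  shows "mono W"
proof (rule monoI)
  fix y y' :: real
  assume "y \<le> y'"
  show "W y \<le> W y'"
  proof (cases "y = y'")
    case False
    with \<open>y \<le> y'\<close> have "Hle y \<le> Hlt y'"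
      unfolding Hle_def Hlt_def by (intro finite_measure_mono) auto
    then have "Hle y ^ m \<le> Hlt y' ^ m" by (intro power_mono) (auto simp: Hle_def)
    then show ?thesis using assms(2)[of y] assms(1)[of y'] by linarith
  qed simp
qed

lemma win_le:
  fixes i :: "'i::finite"
  assumes "CARD('i) = Suc m"
  shows "win D \<beta> i y \<le> Hle y ^ m"
proof -
  have "0 \<le> (1 - 1 / real (Suc m)) * Heq y ^ m"
    by (intro mult_nonneg_nonneg) (auto simp: Heq_def)
  then show ?thesis using win_bounds(2)[OF assms, of i y] by linarith
qed

lemma win_measurable:
  fixes i :: "'i::finite"
  assumes "CARD('i) = Suc m"
  shows "win D \<beta> i \<in> borel_measurable borel"
  by (intro borel_measurable_mono mono_of_H_bounds win_bounds win_le assms)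

text \<open>Tonelli with the coordinate of bidder \<open>i\<close> split off: reserve and price
  depend on the own bid alone, and the integral over the rivals is \<open>win\<close>.\<close>

lemma nn_integral_FP_payment:
  fixes i :: "'i::finite"
  shows "(\<integral>\<^sup>+w. ennreal (FP_alloc \<rho> (\<lambda>k. \<beta> (w k)) i * \<beta> (w i)) \<partial>(\<Pi>\<^sub>M k\<in>UNIV. D)) =
    (\<integral>\<^sup>+v. ennreal (of_bool (\<rho> \<le> \<beta> v) * (win D \<beta> i (\<beta> v) * \<beta> v)) \<partial>D)"
    and FP_payment_measurable: "(\<lambda>w. FP_alloc \<rho> (\<lambda>k. \<beta> (w k)) i * \<beta> (w i))
      \<in> borel_measurable (\<Pi>\<^sub>M k\<in>UNIV. D)"
proof -
  define p where "p w = FP_alloc \<rho> (\<lambda>k. \<beta> (w k)) i * \<beta> (w i)" for w :: "'i \<Rightarrow> real"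
  define J where "J = UNIV - {i}"
  have J: "insert i J = UNIV" "i \<notin> J" "finite J" by (auto simp: J_def)
  have coord: "(\<lambda>w. \<beta> (w k)) \<in> borel_measurable (\<Pi>\<^sub>M k\<in>K. D)" if "k \<in> K" for k :: 'i and K
  proof -
    have "(\<lambda>w. w k) \<in> measurable (\<Pi>\<^sub>M k\<in>K. D) D"
      by (rule measurable_component_singleton[OF that])
    then show ?thesis
      by (intro measurable_compose[OF _ bid_measurable]) (simp cong: measurable_cong_sets)
  qed
  have "p \<in> borel_measurable (\<Pi>\<^sub>M k\<in>UNIV. D)"
  proof -
    have c: "(\<lambda>w. \<beta> (w k)) \<in> borel_measurable (\<Pi>\<^sub>M k\<in>UNIV. D)" for k :: 'i
      by (rule coord) simp
    note [measurable] = c tie_share_measurable[OF c]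
    show ?thesis unfolding p_def FP_alloc_eq by measurable
  qed
  then show meas: "(\<lambda>w. FP_alloc \<rho> (\<lambda>k. \<beta> (w k)) i * \<beta> (w i)) \<in> borel_measurable (\<Pi>\<^sub>M k\<in>UNIV. D)"
    by (simp add: p_def[abs_def])
  interpret P: product_prob_space "\<lambda>_. D" UNIV by unfold_locales
  interpret PJ: prob_space "\<Pi>\<^sub>M k\<in>J. D" by (intro prob_space_PiM) unfold_locales
  have inner: "(\<integral>\<^sup>+w. ennreal (p (w(i := v))) \<partial>(\<Pi>\<^sub>M k\<in>J. D)) =
      ennreal (of_bool (\<rho> \<le> \<beta> v) * (win D \<beta> i (\<beta> v) * \<beta> v))" for v
  proof -
    define s where "s w = tie_share (\<lambda>k. if k = i then \<beta> v else \<beta> (w k)) i" for w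
    have p_s: "p (w(i := v)) = of_bool (\<rho> \<le> \<beta> v) * \<beta> v * s w" for w
    proof -
      have "(\<lambda>k. \<beta> ((w(i := v)) k)) = (\<lambda>k. if k = i then \<beta> v else \<beta> (w k))" by auto
      then show ?thesis by (simp add: p_def FP_alloc_eq s_def mult_ac)
    qed
    have win_s: "win D \<beta> i (\<beta> v) = PJ.expectation s"
      by (simp add: win_def s_def[abs_def] J_def)
    have s_nonneg: "0 \<le> s w" for w by (simp add: s_def tie_share_nonneg)
    have win_nonneg: "0 \<le> win D \<beta> i (\<beta> v)" by (simp add: win_s s_nonneg)
    show ?thesis
    \<comment> \<open>\<open>\<beta>\<close> is unrestricted at negative values; for a negative bid
      \<open>ennreal\<close> sends both sides to 0.\<close>
    proof (cases "0 \<le> \<beta> v")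
      case True
      have "(\<lambda>w. if k = i then \<beta> v else \<beta> (w k)) \<in> borel_measurable (\<Pi>\<^sub>M k\<in>J. D)" for k
        using coord[of k J] by (cases "k = i") (auto simp: J_def)
      then have "s \<in> borel_measurable (\<Pi>\<^sub>M k\<in>J. D)"
        unfolding s_def by (intro tie_share_measurable)
      then have "integrable (\<Pi>\<^sub>M k\<in>J. D) s"
        by (intro PJ.integrable_const_bound[where B = 1])
           (auto simp: s_def tie_share_nonneg tie_share_le_1)
      then show ?thesis
        using True s_nonneg
        by (simp add: p_s nn_integral_eq_integral win_s mult_ac)
    next
      case False
      then have "p (w(i := v)) \<le> 0" for w
        by (simp add: p_s s_nonneg mult_nonpos_nonneg mult_nonneg_nonpos)
      moreover have "of_bool (\<rho> \<le> \<beta> v) * (win D \<beta> i (\<beta> v) * \<beta> v) \<le> 0"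
        using False win_nonneg by (simp add: mult_nonneg_nonpos)
      ultimately show ?thesis by (simp add: ennreal_neg)
    qed
  qed
  have "(\<integral>\<^sup>+w. ennreal (p w) \<partial>(\<Pi>\<^sub>M k\<in>insert i J. D)) =
      (\<integral>\<^sup>+v. (\<integral>\<^sup>+w. ennreal (p (w(i := v))) \<partial>(\<Pi>\<^sub>M k\<in>J. D)) \<partial>D)"
    using \<open>p \<in> borel_measurable _\<close> J
    by (intro P.product_nn_integral_insert_rev) auto
  also have "\<dots> = (\<integral>\<^sup>+v. ennreal (of_bool (\<rho> \<le> \<beta> v) * (win D \<beta> i (\<beta> v) * \<beta> v)) \<partial>D)"
    by (intro nn_integral_cong inner)
  finally show "(\<integral>\<^sup>+w. ennreal (FP_alloc \<rho> (\<lambda>k. \<beta> (w k)) i * \<beta> (w i)) \<partial>(\<Pi>\<^sub>M k\<in>UNIV. D)) =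
    (\<integral>\<^sup>+v. ennreal (of_bool (\<rho> \<le> \<beta> v) * (win D \<beta> i (\<beta> v) * \<beta> v)) \<partial>D)"
    unfolding J p_def .
qed

text \<open>Payments are almost surely nonnegative, so integrability of their sum passes to each
  bidder and then, through the nonnegative integral, to the payment as a function of the own
  value.\<close>

lemma integral_FP_total_payment:
  assumes m: "CARD('i::finite) = Suc m"
    and nonneg: "AE v in D. 0 \<le> \<beta> v"
    and int: "integrable (\<Pi>\<^sub>M k\<in>(UNIV :: 'i set). D) (total_payment (FP \<rho>) \<beta>)"
  shows "integrable D (\<lambda>v. of_bool (\<rho> \<le> \<beta> v) * (win D \<beta> (i :: 'i) (\<beta> v) * \<beta> v))"
    and "(\<integral>w. total_payment (FP \<rho>) \<beta> w \<partial>(\<Pi>\<^sub>M k\<in>(UNIV :: 'i set). D)) =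
      (\<Sum>i\<in>(UNIV :: 'i set). \<integral>v. of_bool (\<rho> \<le> \<beta> v) * (win D \<beta> i (\<beta> v) * \<beta> v) \<partial>D)"
proof -
  define P where "P = (\<Pi>\<^sub>M k\<in>(UNIV :: 'i set). D)"
  define p where "p i w = FP_alloc \<rho> (\<lambda>k. \<beta> (w k)) i * \<beta> (w i)" for i :: 'i and w
  define q where "q i v = of_bool (\<rho> \<le> \<beta> v) * (win D \<beta> i (\<beta> v) * \<beta> v)" for i :: 'i and v
  have total: "total_payment (FP \<rho>) \<beta> w = (\<Sum>i\<in>UNIV. p i w)" for w
    by (simp add: total_payment_def FP_def p_def)
  have p_meas: "p i \<in> borel_measurable P" for i
    unfolding P_def p_def by (rule FP_payment_measurable)
  have nn: "(\<integral>\<^sup>+w. ennreal (p i w) \<partial>P) = (\<integral>\<^sup>+v. ennreal (q i v) \<partial>D)" for i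
    unfolding P_def p_def q_def by (rule nn_integral_FP_payment)
  have bid_i: "AE w in P. 0 \<le> \<beta> (w i)" for i
    unfolding P_def by (intro AE_PiM_component nonneg) (auto intro: prob_space_axioms)
  have p_nonneg: "AE w in P. 0 \<le> p i w" for i
    using bid_i[of i] by eventually_elim (simp add: p_def FP_alloc_eq tie_share_nonneg)
  have p_all: "AE w in P. \<forall>i. 0 \<le> p i w"
    using p_nonneg by (subst AE_all_countable) auto
  have p_int: "integrable P (p i)" for i
  proof (rule Bochner_Integration.integrable_bound[OF int[folded P_def] p_meas])
    show "AE w in P. norm (p i w) \<le> norm (total_payment (FP \<rho>) \<beta> w)"
      using p_all
    proof eventually_elim
      case (elim w)
      then have "p i w \<le> (\<Sum>i\<in>UNIV. p i w)" by (intro member_le_sum) auto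
      then show ?case using elim by (simp add: total)
    qed
  qed
  have win_nonneg: "0 \<le> win D \<beta> i y" for i :: 'i and y
    by (simp add: win_def tie_share_nonneg)
  have q_nonneg: "AE v in D. 0 \<le> q i v" for i
    using nonneg by eventually_elim (simp add: q_def win_nonneg)
  have q_meas: "q i \<in> borel_measurable D" for i
  proof -
    note [measurable] = win_measurable[OF m, of i]
    show ?thesis unfolding q_def by measurable
  qed
  have "(\<integral>\<^sup>+v. ennreal (q i v) \<partial>D) = ennreal (\<integral>w. p i w \<partial>P)" for i
    unfolding nn[symmetric] by (rule nn_integral_eq_integral[OF p_int p_nonneg])
  then have q: "integrable D (q i)" "(\<integral>v. q i v \<partial>D) = (\<integral>w. p i w \<partial>P)" for i
    using q_meas[of i] q_nonneg[of i] integral_nonneg_AE[OF p_nonneg[of i]]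
      nn_integral_eq_integrable[of "q i" D "\<integral>w. p i w \<partial>P"] by auto
  show "integrable D (\<lambda>v. of_bool (\<rho> \<le> \<beta> v) * (win D \<beta> i (\<beta> v) * \<beta> v))" for i :: 'i
    using q(1)[of i] by (simp add: q_def[abs_def])
  have "(\<integral>w. total_payment (FP \<rho>) \<beta> w \<partial>P) = (\<Sum>i\<in>UNIV. \<integral>v. q i v \<partial>D)"
    unfolding total q(2) using p_int by (intro Bochner_Integration.integral_sum) auto
  then show "(\<integral>w. total_payment (FP \<rho>) \<beta> w \<partial>(\<Pi>\<^sub>M k\<in>(UNIV :: 'i set). D)) =
      (\<Sum>i\<in>(UNIV :: 'i set). \<integral>v. of_bool (\<rho> \<le> \<beta> v) * (win D \<beta> i (\<beta> v) * \<beta> v) \<partial>D)"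
    by (simp add: P_def q_def)
qed

end

section \<open>Equilibria with two reserves\<close>

text \<open>The exchanges with reserve \<open>a\<close> have total weight \<open>\<alpha>\<close>:
  the deviator's weight after lowering a reserve, the weight of all others after raising
  one.\<close>

locale two_step = value_model D f m for D f m +
  fixes a b t \<alpha> :: real
  assumes a_nonneg: "0 \<le> a" and a_le_b: "a \<le> b" and b_le_t: "b \<le> t"
    and \<alpha>_pos: "0 < \<alpha>" and \<alpha>_less_1: "\<alpha> < 1"
    and threshold: "(t - b) * G t = \<alpha> * (I t - I a)"
begin

lemma t_nonneg: "0 \<le> t" and a_le_t: "a \<le> t"
  using a_nonneg a_le_b b_le_t by linarith+

text \<open>Total weight of the exchanges that accept a bid \<open>y\<close>.\<close>

definition A :: "real \<Rightarrow> real" where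
  "A y = \<alpha> * of_bool (a \<le> y) + (1 - \<alpha>) * of_bool (b \<le> y)"

lemma A_simps: "y < a \<Longrightarrow> A y = 0" "a \<le> y \<Longrightarrow> y < b \<Longrightarrow> A y = \<alpha>" "b \<le> y \<Longrightarrow> A y = 1"
  using a_le_b by (auto simp: A_def)

lemma A_nonneg: "0 \<le> A y" and A_mono: "y \<le> y' \<Longrightarrow> A y \<le> A y'"
  and A_pos_iff: "0 < A y \<longleftrightarrow> a \<le> y" and A_ge: "a \<le> y \<Longrightarrow> \<alpha> \<le> A y"
  using \<alpha>_pos \<alpha>_less_1 a_le_b by (auto simp: A_def)

text \<open>The difference is the gain of a type from buying everywhere at price \<open>b\<close>
  rather than only at the low reserve. Its first term grows at rate at least \<open>G\<close>, the
  second only at rate \<open>\<alpha> * G\<close>, so \<open>t\<close> is a single crossing.\<close>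

lemma gap_strict_mono:
  assumes "b \<le> u" "u < v"
  shows "(u - b) * G u - \<alpha> * (I u - I a) < (v - b) * G v - \<alpha> * (I v - I a)"
proof -
  have u0: "0 \<le> u" using assms a_nonneg a_le_b by linarith
  have "(u - b) * G u \<le> (u - b) * G v"
    using assms G_mono[of u v] by (intro mult_left_mono) auto
  moreover have "\<alpha> * (I v - I u) \<le> \<alpha> * (G v * (v - u))"
    using I_upper[of u v] u0 assms \<alpha>_pos by (intro mult_left_mono) auto
  moreover have "\<alpha> * (G v * (v - u)) < 1 * (G v * (v - u))"
    using assms u0 \<alpha>_less_1 G_pos[of v] by (intro mult_strict_right_mono) auto
  ultimately show ?thesis by (simp add: algebra_simps)
qed

end

text \<open>\<open>W\<close> stands for \<open>win D \<beta> i\<close>; keeping only its bounds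
  frees the analysis from the product space and the index \<open>i\<close>.\<close>

locale equilibrium = two_step D f m a b t \<alpha> + bid_model D \<beta> m
  for D f m a b t \<alpha> \<beta> +
  fixes W :: "real \<Rightarrow> real"
  assumes W_lower: "Hlt y ^ m \<le> W y"
    and W_upper: "W y \<le> Hle y ^ m - (1 - 1 / real (Suc m)) * Heq y ^ m"
    and W_share: "Hle y ^ m / real (Suc m) \<le> W y"
    and bid_nonneg: "0 \<le> v \<Longrightarrow> 0 \<le> \<beta> v"
    and optimal: "0 \<le> v \<Longrightarrow> 0 \<le> y \<Longrightarrow> A y * W y * (v - y) \<le> A (\<beta> v) * W (\<beta> v) * (v - \<beta> v)"
begin

lemma H_nonneg: "0 \<le> Hle y" "0 \<le> Hlt y" "0 \<le> Heq y"
  by (simp_all add: Hle_def Hlt_def Heq_def)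

lemma W_le: "W y \<le> Hle y ^ m"
proof -
  have "0 \<le> (1 - 1 / real (Suc m)) * Heq y ^ m"
    using H_nonneg by (intro mult_nonneg_nonneg) auto
  then show ?thesis using W_upper[of y] by linarith
qed

lemma W_nonneg: "0 \<le> W y"
  using W_lower[of y] H_nonneg(2)[of y] zero_le_power[of "Hlt y" m] by linarith

lemma W_mono: "y \<le> y' \<Longrightarrow> W y \<le> W y'"
  using mono_of_H_bounds[OF W_lower W_le] by (rule monoD)

lemma W_pos: "0 < Hle y \<Longrightarrow> 0 < W y"
  using W_share[of y] by (smt (verit) divide_pos_pos of_nat_0_less_iff zero_less_Suc zero_less_power)

definition X where "X y = A y * W y"

definition x where "x v = X (\<beta> v)"

definition U where "U v = x v * (v - \<beta> v)"

lemma X_nonneg: "0 \<le> X y" and X_mono: "y \<le> y' \<Longrightarrow> X y \<le> X y'"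
  unfolding X_def using A_nonneg A_mono W_nonneg W_mono by (auto intro!: mult_mono)

lemma x_nonneg: "0 \<le> x v"
  by (simp add: x_def X_nonneg)

section \<open>Best responses and monotonicity of bids\<close>

lemma best_response: "0 \<le> v \<Longrightarrow> 0 \<le> y \<Longrightarrow> X y * (v - y) \<le> U v"
  using optimal by (simp add: X_def U_def x_def)

text \<open>Type \<open>v\<close> may imitate type \<open>u\<close>. Hence \<open>U\<close> is
  convex with slope \<open>x\<close>, and exchanging the two types gives the upper bound.\<close>

lemma U_subgradient: "0 \<le> u \<Longrightarrow> 0 \<le> v \<Longrightarrow> x u * (v - u) \<le> U v - U u"
  using best_response[of v "\<beta> u"] bid_nonneg[of u] by (simp add: U_def x_def algebra_simps)

lemma U_upper: "0 \<le> u \<Longrightarrow> 0 \<le> v \<Longrightarrow> U v - U u \<le> x v * (v - u)"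
  using U_subgradient[of v u] by (simp add: algebra_simps)

lemma x_mono:
  assumes "0 \<le> u" "u \<le> v"
  shows "x u \<le> x v"
proof (cases "u = v")
  case False
  have "x u * (v - u) \<le> x v * (v - u)"
    using U_subgradient[of u v] U_upper[of u v] assms by linarith
  then show ?thesis using False assms by simp
qed simp

lemma U_nonneg: "0 \<le> v \<Longrightarrow> 0 \<le> U v"
  using best_response[of v 0] mult_nonneg_nonneg[OF X_nonneg[of 0], of v] by simp

lemma U_0: "U 0 = 0"
proof -
  have "x 0 * \<beta> 0 \<ge> 0" using x_nonneg bid_nonneg by simp
  then show ?thesis using U_nonneg[of 0] by (simp add: U_def)
qed

lemma bid_le_value:
  assumes "0 \<le> v" "0 < x v"
  shows "\<beta> v \<le> v"
  using U_nonneg[OF assms(1)] assms(2) by (simp add: U_def zero_le_mult_iff)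

lemma bid_ge_reserve:
  assumes "0 < x v"
  shows "a \<le> \<beta> v"
proof (rule ccontr)
  assume "\<not> a \<le> \<beta> v"
  then have "A (\<beta> v) = 0" by (intro A_simps) auto
  then show False using assms by (simp add: x_def X_def)
qed

text \<open>If the higher type bid less, monotonicity of \<open>X\<close> and of \<open>x\<close>
  would give both bids the same positive winning probability, and the lower type would prefer the
  cheaper bid.\<close>

lemma bid_mono:
  assumes "0 \<le> u" "u \<le> v" "0 < x u"
  shows "\<beta> u \<le> \<beta> v"
proof (rule ccontr)
  assume less: "\<not> \<beta> u \<le> \<beta> v"
  then have "x v \<le> x u" unfolding x_def by (intro X_mono) auto
  with x_mono[OF assms(1,2)] have eq: "x u = x v" by simp
  have "X (\<beta> v) * (u - \<beta> v) \<le> x u * (u - \<beta> u)"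
    using best_response[of u "\<beta> v"] bid_nonneg[of v] assms by (simp add: U_def)
  then have "\<beta> u \<le> \<beta> v" using eq assms(3) by (simp add: x_def)
  with less show False by simp
qed

text \<open>Bids with \<open>Hle y = 0\<close> form a down-closed set \<open>Z\<close>. The event of
  bidding at most a given element of \<open>Z\<close> is null, and countably many such events cover
  all bids in \<open>Z\<close>.\<close>

lemma AE_W_pos: "AE v in D. 0 < W (\<beta> v)"
proof -
  define Z where "Z = {y. Hle y = 0}"
  have down: "y' \<in> Z" if "y \<in> Z" "y' \<le> y" for y y'
  proof -
    have "Hle y' \<le> Hle y"
      unfolding Hle_def using that by (intro finite_measure_mono) auto
    then show ?thesis using that H_nonneg(1)[of y'] by (simp add: Z_def)
  qed
  have null: "AE v in D. \<not> \<beta> v \<le> y" if "y \<in> Z" for y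
    using that by (intro AE_I[where N = "{v. \<beta> v \<le> y}"])
      (auto simp: Z_def Hle_def emeasure_eq_measure)
  have rat: "AE v in D. \<forall>q\<in>\<rat> \<inter> Z. \<not> \<beta> v \<le> q"
    using null by (subst AE_ball_countable) (auto intro: countable_rat countable_subset)
  have "AE v in D. \<beta> v \<notin> Z"
  \<comment> \<open>Either \<open>Z\<close> has a largest element above all its rationals, or its
    rationals are cofinal.\<close>
  proof (cases "\<exists>y0\<in>Z. \<forall>q\<in>\<rat> \<inter> Z. q < y0")
    case True
    then obtain y0 where y0: "y0 \<in> Z" "\<forall>q\<in>\<rat> \<inter> Z. q < y0" by blast
    have top: "y \<le> y0" if y: "y \<in> Z" for y
    proof (rule ccontr)
      assume "\<not> y \<le> y0"
      then obtain q where "q \<in> \<rat>" "y0 < q" "q < y" using Rats_dense_in_real[of y0 y] by auto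
      then have "q \<in> \<rat> \<inter> Z" using down[OF y, of q] by simp
      with y0(2) have "q < y0" by (rule bspec)
      then show False using \<open>y0 < q\<close> by simp
    qed
    show ?thesis using null[OF y0(1)] by eventually_elim (use top in auto)
  next
    case False
    show ?thesis using rat
    proof eventually_elim
      case (elim v)
      show ?case
      proof
        assume "\<beta> v \<in> Z"
        then obtain q where q: "q \<in> \<rat> \<inter> Z" "\<not> q < \<beta> v" using False by blast
        from elim q(1) have "\<not> \<beta> v \<le> q" by (rule bspec)
        then show False using q(2) by simp
      qed
    qed
  qed
  then show ?thesis
  proof eventually_elim
    case (elim v)
    then have "0 < Hle (\<beta> v)" using H_nonneg(1)[of "\<beta> v"] by (simp add: Z_def)
    then show ?case by (rule W_pos)
  qed
qed

(* An atom at y would let the types bidding y gain discretely by bidding slightly more. *)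
lemma no_bid_atom:
  assumes "a \<le> y"
  shows "Heq y = 0"
proof (rule ccontr)
  assume "Heq y \<noteq> 0"
  then have pos: "0 < Heq y" using H_nonneg(3)[of y] by simp
  \<comment> \<open>Values have no atom, so an atom of bids contains a type other than
    \<open>y\<close>. That type has a strictly positive margin, without which a higher bid would not
    pay.\<close>
  have "\<exists>v\<ge>0. v \<noteq> y \<and> \<beta> v = y"
  proof (rule ccontr)
    assume *: "\<not> ?thesis"
    have "AE v in D. \<beta> v \<noteq> y"
      using AE_nonneg AE_neq[of y] by eventually_elim (use * in auto)
    then have "prob {v \<in> space D. \<beta> v = y} = 0"
      by (subst (asm) AE_iff_measurable[OF _ refl]) (auto simp: measure_def)
    then show False using pos by (simp add: Heq_def)
  qed
  then obtain v where v: "0 \<le> v" "v \<noteq> y" "\<beta> v = y" by blast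
  have "Heq y \<le> Hle y" unfolding Heq_def Hle_def by (intro finite_measure_mono) auto
  then have "0 < W y" using pos by (intro W_pos) auto
  moreover have Ay: "0 < A y" using assms by (simp add: A_pos_iff)
  ultimately have "0 < x v" by (simp add: x_def X_def v)
  then have yv: "y < v" using bid_le_value[of v] v by simp
  have "1 / real (Suc m) < 1" using m_pos by simp
  then have "0 < (1 - 1 / real (Suc m)) * Heq y ^ m" using pos by simp
  then have W_less: "W y < Hle y ^ m" using W_upper[of y] by linarith
  \<comment> \<open>Just above \<open>y\<close> all ties are won, and as \<open>A\<close> is
    monotone no exchange is lost.\<close>
  have "A y * Hle y ^ m * (v - y') \<le> X y * (v - y)" if y': "y < y'" "y' \<le> v" for y'
  proof -
    have "Hle y \<le> Hlt y'"
      unfolding Hle_def Hlt_def using y' by (intro finite_measure_mono) auto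
    then have "Hle y ^ m \<le> W y'"
      using W_lower[of y'] power_mono[of "Hle y" "Hlt y'" m] H_nonneg by force
    then have "A y * Hle y ^ m \<le> X y'"
      unfolding X_def using A_mono[of y y'] A_nonneg y' H_nonneg by (intro mult_mono) auto
    then have "A y * Hle y ^ m * (v - y') \<le> X y' * (v - y')"
      using y' by (intro mult_right_mono) auto
    also have "\<dots> \<le> U v" using assms a_nonneg y' v by (intro best_response) auto
    finally show ?thesis by (simp add: U_def x_def v)
  qed
  then have "eventually (\<lambda>y'. A y * Hle y ^ m * (v - y') \<le> X y * (v - y)) (at_right y)"
    using yv by (intro eventually_at_rightI[of y v]) auto
  moreover have "((\<lambda>y'. A y * Hle y ^ m * (v - y')) \<longlongrightarrow> A y * Hle y ^ m * (v - y)) (at_right y)"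
    by (intro tendsto_intros)
  ultimately have "A y * Hle y ^ m * (v - y) \<le> X y * (v - y)"
    by (intro tendsto_upperbound) auto
  then have "Hle y ^ m \<le> W y" using yv Ay by (simp add: X_def)
  with W_less show False by simp
qed

text \<open>Bids increase and ties are null, so the rivals bidding at most \<open>\<beta> v\<close>
  are almost surely those with value at most \<open>v\<close>.\<close>

lemma W_bid:
  assumes "0 \<le> v" "0 < x v"
  shows "W (\<beta> v) = G v"
proof -
  have res: "a \<le> \<beta> v" by (rule bid_ge_reserve[OF assms(2)])
  have Heq: "Heq (\<beta> v) = 0" by (rule no_bid_atom[OF res])
  have "Hle (\<beta> v) = Hlt (\<beta> v) + Heq (\<beta> v)"
    unfolding Hle_def Hlt_def Heq_def
    by (subst finite_measure_Union[symmetric]) (auto intro!: arg_cong[where f = prob])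
  then have "W (\<beta> v) = Hle (\<beta> v) ^ m"
    using W_lower[of "\<beta> v"] W_le[of "\<beta> v"] Heq by simp
  moreover have "Hle (\<beta> v) = F v"
    unfolding Hle_def F_def
  proof (rule measure_eq_AE)
    have "AE z in D. \<beta> z \<noteq> \<beta> v"
      using Heq by (intro AE_I[where N = "{z. \<beta> z = \<beta> v}"])
        (auto simp: Heq_def emeasure_eq_measure)
    then show "AE z in D. z \<in> {z. \<beta> z \<le> \<beta> v} \<longleftrightarrow> z \<in> {..v}"
      using AE_nonneg AE_W_pos AE_neq[of v]
    proof eventually_elim
      case (elim z)
      show ?case
      proof (cases "z < v")
        case True
        have "\<beta> z \<le> \<beta> v"
        proof (cases "0 < x z")
          \<comment> \<open>A type with \<open>x z = 0\<close> although \<open>W (\<beta> z)\<close>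
            is positive bids below every reserve.\<close>
          case False
          then have "\<not> 0 < A (\<beta> z)" using elim x_nonneg[of z] by (auto simp: x_def X_def)
          then show ?thesis using res by (simp add: A_pos_iff)
        qed (use True elim bid_mono in auto)
        then show ?thesis using True by simp
      next
        case False
        then have "\<beta> v \<le> \<beta> z" using assms elim by (intro bid_mono) auto
        then show ?thesis using False elim by auto
      qed
    qed
  qed simp_all
  ultimately show ?thesis by (simp add: G_def)
qed

lemma x_eq: "0 \<le> v \<Longrightarrow> 0 < x v \<Longrightarrow> x v = A (\<beta> v) * G v"
  using W_bid[of v] by (simp add: x_def X_def)

lemma x_below: "0 \<le> v \<Longrightarrow> v < a \<Longrightarrow> x v = 0"
  using bid_le_value[of v] bid_ge_reserve[of v] x_nonneg[of v] by linarith

lemma Hlt_ge: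
  assumes "a \<le> y" "0 \<le> v" "\<And>z. 0 \<le> z \<Longrightarrow> z < v \<Longrightarrow> 0 < x z \<Longrightarrow> \<beta> z < y"
  shows "F v \<le> Hlt y"
  unfolding F_def Hlt_def
proof (rule finite_measure_mono_AE)
  show "AE z in D. z \<in> {..v} \<longrightarrow> z \<in> {z. \<beta> z < y}"
    using AE_nonneg AE_neq[of v] AE_W_pos
  proof eventually_elim
    case (elim z)
    show ?case
    proof (cases "0 < x z")
      case False
      then have "\<not> 0 < A (\<beta> z)" using elim x_nonneg[of z] by (auto simp: x_def X_def)
      then show ?thesis using assms by (simp add: A_pos_iff)
    qed (use elim assms in auto)
  qed
qed simp

text \<open>By bidding the midpoint \<open>c\<close> the type beats almost all values below
  \<open>c\<close>: winning types bid at most their value, the others below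
  \<open>a\<close>.\<close>

lemma x_pos:
  assumes "a < v"
  shows "0 < x v"
proof -
  define c where "c = (a + v) / 2"
  have c: "a < c" "c < v" using assms by (auto simp: c_def)
  have "F c \<le> Hlt c"
    using c a_nonneg bid_le_value by (intro Hlt_ge) force+
  then have "0 < Hlt c" using F_pos[of c] c a_nonneg by linarith
  moreover have "Hlt c \<le> Hle c"
    unfolding Hle_def Hlt_def by (intro finite_measure_mono) auto
  ultimately have "0 < X c"
    unfolding X_def using c by (intro mult_pos_pos W_pos) (auto simp: A_pos_iff)
  then have "0 < X c * (v - c)" using c by simp
  also have "\<dots> \<le> U v" using c a_nonneg by (intro best_response) auto
  finally show ?thesis using x_nonneg[of v] by (auto simp: U_def zero_less_mult_iff)
qed

lemma x_above:
  assumes "a < v"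
  shows "x v = A (\<beta> v) * G v" "a \<le> \<beta> v"
  using assms x_pos a_nonneg by (auto intro!: x_eq bid_ge_reserve)

lemma x_above_ge: "a < v \<Longrightarrow> \<alpha> * G v \<le> x v"
  using x_above[of v] A_ge G_nonneg by (simp add: mult_right_mono)

section \<open>Utilities, the switch at \<open>t\<close>, and payments\<close>

lemma U_a: "U a = 0"
proof -
  have "U a - U 0 \<le> (\<lambda>_. 0) a - (\<lambda>_. 0 :: real) (0 :: real)"
    by (rule envelope_compare[where x = "\<lambda>_. 0" and y = x])
       (use a_nonneg U_upper x_below in auto)
  then show ?thesis using U_0 U_nonneg[OF a_nonneg] by simp
qed

text \<open>Every bid of a type above \<open>a\<close> is accepted with weight at least
  \<open>\<alpha>\<close>, so this rent is guaranteed before the switch at \<open>t\<close> is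
  known.\<close>

lemma U_ge:
  assumes "a \<le> v"
  shows "\<alpha> * (I v - I a) \<le> U v"
proof -
  have "\<alpha> * I v - \<alpha> * I a \<le> U v - U a"
  proof (rule envelope_compare[where V = "\<lambda>v. \<alpha> * I v" and y = "\<lambda>v. \<alpha> * G v" and U = U and x = x])
    fix u v assume uv: "a \<le> u" "u \<le> v"
    show "x u * (v - u) \<le> U v - U u" using uv a_nonneg by (intro U_subgradient) auto
    show "\<alpha> * I v - \<alpha> * I u \<le> \<alpha> * G v * (v - u)"
      using uv a_nonneg \<alpha>_pos I_upper[of u v] by (simp add: mult_left_mono mult.assoc flip: right_diff_distrib)
  next
    fix u v assume uv: "a \<le> u" "u < v"
    have "\<alpha> * G u \<le> \<alpha> * G v" using uv \<alpha>_pos by (simp add: G_mono)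
    also have "\<dots> \<le> x v" using uv by (intro x_above_ge) auto
    finally show "\<alpha> * G u \<le> x v" .
  qed (rule assms)
  then show ?thesis by (simp add: U_a right_diff_distrib)
qed

lemma U_low:
  assumes "a \<le> v" and low: "\<And>z. a < z \<Longrightarrow> z < v \<Longrightarrow> \<beta> z < b"
  shows "U v = \<alpha> * (I v - I a)"
proof -
  have x_low: "x z = \<alpha> * G z" if "a < z" "z < v" for z
    using x_above[of z] low[of z] that A_simps by simp
  have "U v - U a \<le> \<alpha> * I v - \<alpha> * I a"
  proof (rule envelope_compare[where U = "\<lambda>v. \<alpha> * I v" and x = "\<lambda>v. \<alpha> * G v" and V = U and y = x])
    fix u v assume uv: "a \<le> u" "u \<le> v"
    show "U v - U u \<le> x v * (v - u)" using uv a_nonneg by (intro U_upper) auto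
    show "\<alpha> * G u * (v - u) \<le> \<alpha> * I v - \<alpha> * I u"
      using uv a_nonneg \<alpha>_pos I_lower[of u v] by (simp add: mult_left_mono mult.assoc flip: right_diff_distrib)
  next
    fix u z assume uz: "a \<le> u" "u < z" "z \<le> v"
    \<comment> \<open>The slope is known only strictly between \<open>a\<close> and
      \<open>v\<close>; the midpoint covers the ends.\<close>
    define w where "w = (u + z) / 2"
    have w: "u < w" "w < z" using uz by (auto simp: w_def)
    have "x u \<le> x w" using uz w a_nonneg by (intro x_mono) auto
    also have "\<dots> = \<alpha> * G w" using uz w by (intro x_low) auto
    also have "\<dots> \<le> \<alpha> * G z" using w \<alpha>_pos by (simp add: G_mono)
    finally show "x u \<le> \<alpha> * G z" .
  qed (rule assms)
  then show ?thesis using U_ge[OF assms(1)] by (simp add: U_a right_diff_distrib)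
qed

text \<open>Bidding at least \<open>b\<close> earns at most \<open>(v - b) * G v\<close>, which
  below \<open>t\<close> is less than the rent of \<open>U_ge\<close>.\<close>

lemma bid_low:
  assumes "a < v" "v < t"
  shows "\<beta> v < b"
proof (rule ccontr)
  assume "\<not> \<beta> v < b"
  then have bv: "b \<le> \<beta> v" by simp
  have v0: "0 \<le> v" using assms a_nonneg by simp
  have "\<beta> v \<le> v" using assms v0 x_pos by (intro bid_le_value)
  then have "b \<le> v" using bv by simp
  have "x v = G v" using x_above[OF assms(1)] bv A_simps by simp
  then have "U v \<le> (v - b) * G v"
    using bv G_nonneg[of v] mult_right_mono[of "v - \<beta> v" "v - b" "G v"]
    by (simp add: U_def mult.commute)
  then show False
    using gap_strict_mono[OF \<open>b \<le> v\<close> assms(2)] U_ge[of v] assms threshold by simp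
qed

text \<open>If type \<open>v\<close> bid below \<open>b\<close>, so would all lower winning types.
  Its utility would be the low rent, while the bid \<open>b\<close> would win with probability at
  least \<open>G v\<close> and, above \<open>t\<close>, earn more.\<close>

lemma bid_high:
  assumes "t < v"
  shows "b \<le> \<beta> v"
proof (rule ccontr)
  assume "\<not> b \<le> \<beta> v"
  then have bv: "\<beta> v < b" by simp
  have v: "a < v" "0 \<le> v" "b \<le> v" using assms a_le_t t_nonneg b_le_t by auto
  have low: "\<beta> z < b" if "0 \<le> z" "z < v" "0 < x z" for z
    using bid_mono[of z v] that bv by simp
  have "U v = \<alpha> * (I v - I a)"
    using v a_nonneg x_pos by (intro U_low low) auto
  moreover have "F v \<le> Hlt b"
    using v a_le_b low by (intro Hlt_ge) auto
  then have "G v \<le> W b"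
    using W_lower[of b] power_mono[of "F v" "Hlt b" m] F_nonneg[of v] by (simp add: G_def)
  then have "G v * (v - b) \<le> X b * (v - b)"
    using v A_simps(3)[of b] by (simp add: X_def mult_right_mono)
  moreover have "X b * (v - b) \<le> U v"
    using v a_nonneg a_le_b by (intro best_response) auto
  ultimately show False
    using gap_strict_mono[OF b_le_t assms] threshold by (simp add: mult.commute)
qed

text \<open>The left side is what a single accepting exchange receives, so the weight
  \<open>\<alpha>\<close> in utility and allocation cancels.\<close>

lemma payment_low:
  assumes "a < v" "v < t"
  shows "W (\<beta> v) * \<beta> v = v * G v - (I v - I a)"
proof -
  have W: "W (\<beta> v) = G v" using assms a_nonneg x_pos by (intro W_bid) auto
  have "U v = \<alpha> * (I v - I a)"
    using assms bid_low by (intro U_low) auto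
  moreover have "x v = \<alpha> * G v"
    using x_above[OF assms(1)] bid_low[OF assms] A_simps by simp
  ultimately have "\<alpha> * (G v * (v - \<beta> v)) = \<alpha> * (I v - I a)" by (simp add: U_def)
  then have "G v * (v - \<beta> v) = I v - I a" using \<alpha>_pos by simp
  then show ?thesis by (simp add: W algebra_simps)
qed

text \<open>The rent is accumulated at slope \<open>\<alpha> * G\<close> up to \<open>t\<close> and
  at slope \<open>G\<close> afterwards.\<close>

lemma payment_high:
  assumes "t < v"
  shows "W (\<beta> v) * \<beta> v = v * G v - \<alpha> * (I t - I a) - (I v - I t)"
proof -
  have v: "a < v" "0 \<le> v" using assms a_le_t t_nonneg by auto
  have W: "W (\<beta> v) = G v" using v x_pos by (intro W_bid) auto
  have xG: "x z = G z" if "t < z" for z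
    using x_above[of z] bid_high[OF that] that a_le_t A_simps by simp
  have Ut: "U t = \<alpha> * (I t - I a)"
    using a_le_t bid_low by (intro U_low) auto
  have "U v - U t \<le> I v - I t"
  proof (rule envelope_compare[where U = I and x = G and V = U and y = x])
    fix u z assume uz: "t \<le> u" "u < z" "z \<le> v"
    have "x u \<le> x z" using uz t_nonneg by (intro x_mono) auto
    then show "x u \<le> G z" using uz xG[of z] by simp
  qed (use assms t_nonneg I_lower U_upper in auto)
  moreover have "I v - I t \<le> U v - U t"
  proof (rule envelope_compare[where U = U and x = x and V = I and y = G])
    fix u z assume uz: "t \<le> u" "u < z" "z \<le> v"
    then show "G u \<le> x z" using xG[of z] G_mono[of u z] by simp
  qed (use assms t_nonneg I_upper U_subgradient in auto)
  ultimately have "G v * (v - \<beta> v) = \<alpha> * (I t - I a) + (I v - I t)"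
    using xG[OF assms] Ut by (simp add: U_def)
  then show ?thesis by (simp add: W algebra_simps)
qed

lemma AE_bid_below: "AE v in D. v < a \<longrightarrow> \<beta> v < a"
  using AE_nonneg AE_W_pos
proof eventually_elim
  case (elim v)
  show ?case
  proof
    assume "v < a"
    then have "x v = 0" using elim by (intro x_below) auto
    then have "\<not> 0 < A (\<beta> v)" using elim by (auto simp: x_def X_def)
    then show "\<beta> v < a" by (simp add: A_pos_iff)
  qed
qed

lemma AE_payment_a:
  "AE v in D. of_bool (a \<le> \<beta> v) * (W (\<beta> v) * \<beta> v) =
     (if v < a then 0 else if v < t then v * G v - (I v - I a)
      else v * G v - \<alpha> * (I t - I a) - (I v - I t))"
  using AE_bid_below AE_neq[of a] AE_neq[of t]
  by eventually_elim (use payment_low payment_high x_above a_le_t in auto)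

lemma AE_payment_b:
  "AE v in D. of_bool (b \<le> \<beta> v) * (W (\<beta> v) * \<beta> v) =
     (if v < t then 0 else v * G v - \<alpha> * (I t - I a) - (I v - I t))"
  using AE_bid_below AE_neq[of a] AE_neq[of t]
proof eventually_elim
  case (elim v)
  consider "v < a" | "a < v" "v < t" | "t < v" using elim by linarith
  then show ?case
    using elim bid_low[of v] bid_high[of v] payment_high[of v] a_le_b a_le_t by cases auto
qed

end

section \<open>Existence of an equilibrium\<close>

context two_step
begin

definition eq_x :: "real \<Rightarrow> real" where
  "eq_x v = (if v < a then 0 else if v < t then \<alpha> * G v else G v)"

definition eq_U :: "real \<Rightarrow> real" where
  "eq_U v = (if v < a then 0 else if v < t then \<alpha> * (I v - I a)
     else \<alpha> * (I t - I a) + (I v - I t))"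

text \<open>Solves \<open>eq_x v * (v - eq_bid v) = eq_U v\<close>, with allocation and utility as
  dictated by the necessary conditions. Types that never win bid 0.\<close>

definition eq_bid :: "real \<Rightarrow> real" where
  "eq_bid v = (if 0 < eq_x v then v - eq_U v / eq_x v else 0)"

lemma eq_x_nonneg: "0 \<le> eq_x v"
  using \<alpha>_pos G_nonneg by (simp add: eq_x_def)

lemma \<alpha>_G_le: "\<alpha> * G v \<le> G v"
  using mult_right_mono[of \<alpha> 1 "G v"] \<alpha>_less_1 G_nonneg[of v] by simp

lemma eq_x_mono:
  assumes "u \<le> v"
  shows "eq_x u \<le> eq_x v"
proof -
  have "\<alpha> * G u \<le> \<alpha> * G v" "G u \<le> G v" "\<alpha> * G v \<le> G v" "0 \<le> \<alpha> * G v"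
    using \<alpha>_pos G_mono[OF assms] G_nonneg[of v] \<alpha>_G_le by auto
  then show ?thesis using assms a_le_t G_nonneg[of v] by (auto simp: eq_x_def)
qed

lemma eq_x_strict_mono:
  assumes "0 \<le> u" "a \<le> u" "u < v"
  shows "eq_x u < eq_x v"
proof -
  have "G u < G v" using assms G_strict_mono by simp
  moreover have "\<alpha> * G u < \<alpha> * G v" using \<open>G u < G v\<close> \<alpha>_pos by simp
  ultimately show ?thesis using assms \<alpha>_G_le[of v] by (auto simp: eq_x_def)
qed

lemma eq_x_pos_iff: "0 \<le> v \<Longrightarrow> 0 < eq_x v \<longleftrightarrow> a \<le> v \<and> 0 < v"
  using G_pos[of v] G_0 \<alpha>_pos a_nonneg by (cases "v = 0") (auto simp: eq_x_def)

text \<open>The two-sided bound concatenates because \<open>eq_x\<close> is monotone, so it is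
  enough to check the pieces cut out by \<open>a\<close> and \<open>t\<close>.\<close>

lemma eq_U_envelope:
  assumes "0 \<le> u" "u \<le> v"
  shows "eq_x u * (v - u) \<le> eq_U v - eq_U u \<and> eq_U v - eq_U u \<le> eq_x v * (v - u)"
    (is "?P u v")
proof -
  have chain: "?P u w" if "?P u v" "?P v w" "u \<le> v" "v \<le> w" for u v w
  proof -
    have "eq_x u * (w - v) \<le> eq_x v * (w - v)" "eq_x v * (v - u) \<le> eq_x w * (v - u)"
      using that eq_x_mono by (auto intro!: mult_right_mono)
    with that show ?thesis by (auto simp: algebra_simps)
  qed
  have low: "?P u v" if "0 \<le> u" "u \<le> v" "v \<le> a" for u v
  proof (cases "u = v")
    case False
    then have "eq_x u = 0" "eq_U u = 0" "eq_U v = 0"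
      using that a_le_t by (auto simp: eq_x_def eq_U_def)
    then show ?thesis using that eq_x_nonneg[of v] by simp
  qed simp
  have mid: "?P u v" if uv: "a \<le> u" "u \<le> v" "v \<le> t" for u v
  proof (cases "u = v")
    case False
    have "eq_U w = \<alpha> * (I w - I a)" if "a \<le> w" "w \<le> t" for w
      using that by (cases "w = t") (auto simp: eq_U_def)
    then have "eq_U v - eq_U u = \<alpha> * (I v - I u)" using uv by (simp add: right_diff_distrib)
    moreover have "eq_x u = \<alpha> * G u" using False uv by (simp add: eq_x_def)
    moreover have "\<alpha> * G v \<le> eq_x v"
      using uv \<alpha>_G_le[of v] by (auto simp: eq_x_def)
    then have "\<alpha> * G v * (v - u) \<le> eq_x v * (v - u)" using uv by (intro mult_right_mono) auto
    moreover have "\<alpha> * (G u * (v - u)) \<le> \<alpha> * (I v - I u)" "\<alpha> * (I v - I u) \<le> \<alpha> * (G v * (v - u))"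
      using I_lower[of u v] I_upper[of u v] uv a_nonneg \<alpha>_pos by (auto intro!: mult_left_mono)
    ultimately show ?thesis by (simp add: mult.assoc)
  qed simp
  have high: "?P u v" if uv: "t \<le> u" "u \<le> v" for u v
    using I_lower[of u v] I_upper[of u v] uv a_le_t t_nonneg by (auto simp: eq_x_def eq_U_def)
  \<comment> \<open>The cuts are clamped into \<open>[u, v]\<close>; a missing piece degenerates to
    a point.\<close>
  define p q where "p = max u (min v a)" and "q = max u (min v t)"
  have "?P u p" using low[of u p] assms by (cases "u \<le> a") (auto simp: p_def)
  moreover have "?P p q"
    using mid[of p q] assms a_le_t by (cases "a \<le> v \<and> u \<le> t") (auto simp: p_def q_def)
  moreover have "?P q v" using high[of q v] assms by (cases "t \<le> v") (auto simp: q_def)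
  moreover have "u \<le> p" "p \<le> q" "q \<le> v" using assms a_le_t by (auto simp: p_def q_def)
  ultimately show ?thesis using chain[of u p q] chain[of u q v] by force
qed

lemma eq_U_subgradient:
  assumes "0 \<le> u" "0 \<le> v"
  shows "eq_x u * (v - u) + eq_U u \<le> eq_U v"
proof (cases "u \<le> v")
  case True
  then show ?thesis using eq_U_envelope[of u v] assms by simp
next
  case False
  then have "eq_U u - eq_U v \<le> eq_x u * (u - v)" using eq_U_envelope[of v u] assms by simp
  then show ?thesis by (simp add: algebra_simps)
qed

lemma eq_U_below: "v \<le> a \<Longrightarrow> eq_U v = 0"
  using a_le_t by (auto simp: eq_U_def)

lemma eq_U_nonneg: "0 \<le> v \<Longrightarrow> 0 \<le> eq_U v"
  using eq_U_subgradient[of a v] eq_U_subgradient[of 0 v] eq_U_below[of 0] a_nonneg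
    mult_nonneg_nonneg[OF eq_x_nonneg[of 0], of v] by simp

lemma eq_U_le:
  assumes "a \<le> v"
  shows "eq_U v \<le> eq_x v * (v - a)"
  using eq_U_envelope[of a v] eq_U_below[of a] assms a_nonneg by simp

lemma eq_U_pos:
  assumes "a < v"
  shows "0 < eq_U v"
proof -
  define w where "w = (a + v) / 2"
  have w: "a < w" "w < v" using assms by (auto simp: w_def)
  have "0 < eq_x w * (v - w)" using w a_nonneg by (simp add: eq_x_pos_iff)
  then show ?thesis
    using eq_U_subgradient[of w v] eq_U_nonneg[of w] w a_nonneg by linarith
qed

lemma eq_x_eq_bid: "0 < eq_x v \<Longrightarrow> eq_x v * (v - eq_bid v) = eq_U v"
  by (simp add: eq_bid_def)

lemma eq_x_pos_imp: "0 < eq_x v \<Longrightarrow> a \<le> v"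
  by (auto simp: eq_x_def split: if_splits)

lemma eq_bid_ge_a:
  assumes "0 < eq_x v"
  shows "a \<le> eq_bid v"
proof -
  have "eq_x v * (v - eq_bid v) \<le> eq_x v * (v - a)"
    using eq_U_le[of v] eq_x_eq_bid[OF assms] eq_x_pos_imp[OF assms] by simp
  then show ?thesis using assms by simp
qed

lemma eq_bid_nonneg: "0 \<le> eq_bid v"
  using eq_bid_ge_a[of v] a_nonneg by (cases "0 < eq_x v") (auto simp: eq_bid_def)

lemma eq_bid_le:
  assumes "0 \<le> v"
  shows "eq_bid v \<le> v"
  using eq_U_nonneg[OF assms] assms by (auto simp: eq_bid_def)

text \<open>The upper envelope bound gives \<open>eq_x v * eq_bid v \<ge> eq_x u * eq_bid u + u *
  (eq_x v - eq_x u)\<close>, and \<open>u\<close> is at least \<open>eq_bid u\<close>.\<close>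

lemma eq_bid_mono:
  assumes "u \<le> v"
  shows "eq_bid u \<le> eq_bid v"
proof (cases "0 < eq_x u")
  case False
  then show ?thesis using eq_bid_nonneg[of v] by (simp add: eq_bid_def)
next
  case True
  have xv: "0 < eq_x v" using True eq_x_mono[OF assms] by simp
  have u0: "0 \<le> u" using eq_x_pos_imp[OF True] a_nonneg by simp
  have "eq_bid u * (eq_x v - eq_x u) \<le> u * (eq_x v - eq_x u)"
    using eq_bid_le[OF u0] eq_x_mono[OF assms] by (intro mult_right_mono) auto
  then have "eq_x v * eq_bid u \<le> eq_x v * eq_bid v"
    using eq_x_eq_bid[OF True] eq_x_eq_bid[OF xv] eq_U_envelope[OF u0 assms]
    by (simp add: algebra_simps)
  then show ?thesis using xv by simp
qed

lemma eq_bid_strict_mono: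
  assumes "a < u" "u < v"
  shows "eq_bid u < eq_bid v"
proof -
  have u0: "0 \<le> u" using assms a_nonneg by simp
  have xu: "0 < eq_x u" using assms a_nonneg by (simp add: eq_x_pos_iff)
  have less: "eq_x u < eq_x v" using assms u0 by (intro eq_x_strict_mono) auto
  have xv: "0 < eq_x v" using xu less by simp
  have "eq_x u * (u - eq_bid u) > 0" using eq_x_eq_bid[OF xu] eq_U_pos[OF assms(1)] by simp
  then have "eq_bid u < u" using xu by (simp add: zero_less_mult_iff)
  then have "eq_bid u * (eq_x v - eq_x u) < u * (eq_x v - eq_x u)"
    using less by (intro mult_strict_right_mono) auto
  then have "eq_x v * eq_bid u < eq_x v * eq_bid v"
    using eq_x_eq_bid[OF xu] eq_x_eq_bid[OF xv] eq_U_envelope[OF u0, of v] assms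
    by (simp add: algebra_simps)
  then show ?thesis using xv by simp
qed

lemma eq_bid_measurable: "eq_bid \<in> borel_measurable borel"
  by (intro borel_measurable_mono monoI eq_bid_mono)

sublocale eq_bids: bid_model D eq_bid m
  by unfold_locales (rule eq_bid_measurable)

text \<open>The threshold equation says precisely that the upper branch of bids starts at
  \<open>b\<close>.\<close>

lemma eq_bid_t: "eq_bid t = b"
proof (cases "0 < t")
  case True
  then have xt: "eq_x t = G t" "0 < G t" using a_le_t G_pos by (auto simp: eq_x_def)
  have "G t * (t - eq_bid t) = G t * (t - b)"
    using eq_x_eq_bid[of t] xt threshold a_le_t by (simp add: eq_U_def mult.commute)
  then show ?thesis using xt by simp
next
  case False
  then have "t = 0" "b = 0" using t_nonneg b_le_t a_nonneg a_le_b by auto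
  then show ?thesis using eq_bid_le[of 0] eq_bid_nonneg[of 0] by simp
qed

lemma eq_bid_high: "t \<le> v \<Longrightarrow> b \<le> eq_bid v"
  using eq_bid_mono[of t v] eq_bid_t by simp

lemma eq_bid_low:
  assumes "0 < eq_x v" "v < t"
  shows "eq_bid v < b"
proof (cases "v < b")
  case True
  then show ?thesis using eq_bid_le[of v] eq_x_pos_imp[OF assms(1)] a_nonneg by simp
next
  case False
  have av: "a \<le> v" by (rule eq_x_pos_imp[OF assms(1)])
  have x: "eq_x v = \<alpha> * G v" and U: "eq_U v = \<alpha> * (I v - I a)"
    using av assms(2) by (auto simp: eq_x_def eq_U_def)
  have "\<alpha> * (G v * (v - eq_bid v)) = \<alpha> * (I v - I a)"
    using eq_x_eq_bid[OF assms(1)] x U by simp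
  then have "G v * (v - eq_bid v) = I v - I a" using \<alpha>_pos by simp
  moreover have "(v - b) * G v < \<alpha> * (I v - I a)"
    using gap_strict_mono[of v t] False assms threshold by simp
  moreover have "\<alpha> * (I v - I a) \<le> 1 * (I v - I a)"
    using \<alpha>_less_1 I_mono[OF av] by (intro mult_right_mono) auto
  ultimately have "G v * (v - b) < G v * (v - eq_bid v)" by (simp add: mult.commute)
  then show ?thesis using G_nonneg[of v] by (simp add: mult_less_cancel_left)
qed

lemma eq_x_eq_A: "0 < eq_x v \<Longrightarrow> eq_x v = A (eq_bid v) * G v"
  using eq_bid_low[of v] eq_bid_high[of v] eq_bid_ge_a[of v] eq_x_pos_imp[of v] A_simps
  by (cases "v < t") (auto simp: eq_x_def)

lemma G_le_Hlt:
  assumes "0 < eq_x v"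
  shows "G v \<le> eq_bids.Hlt (eq_bid v) ^ m"
proof -
  have "F v \<le> eq_bids.Hlt (eq_bid v)"
    unfolding F_def eq_bids.Hlt_def
  proof (rule finite_measure_mono_AE)
    show "AE z in D. z \<in> {..v} \<longrightarrow> z \<in> {z. eq_bid z < eq_bid v}"
      using AE_nonneg AE_neq[of v] AE_neq[of a]
    proof eventually_elim
      case (elim z)
      have "eq_bid z < eq_bid v" if "z < a"
        using that eq_bid_ge_a[OF assms] elim by (simp add: eq_bid_def eq_x_def)
      then show ?case using eq_bid_strict_mono[of z v] elim by fastforce
    qed
  qed simp
  then show ?thesis unfolding G_def using F_nonneg by (intro power_mono)
qed

text \<open>\<open>y\<close> may fall into a jump of \<open>eq_bid\<close>, so the bound is carried
  to the supremum of the types bidding at most \<open>y\<close>, attained or not, by continuity of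
  \<open>G\<close>.\<close>

lemma Hle_le:
  assumes "0 \<le> y" and le: "\<And>z. 0 \<le> z \<Longrightarrow> eq_bid z \<le> y \<Longrightarrow> G z \<le> q"
  shows "eq_bids.Hle y ^ m \<le> q"
proof (cases "\<forall>z\<ge>0. eq_bid z \<le> y")
  \<comment> \<open>No finite supremum here: the bound passes to the limit 1 of
    \<open>G\<close>.\<close>
  case True
  have "(G \<longlongrightarrow> 1 ^ m) at_top" unfolding G_def by (intro tendsto_power F_at_top)
  then have "1 ^ m \<le> q"
    by (rule tendsto_upperbound)
       (use True le in \<open>auto intro!: eventually_mono[OF eventually_ge_at_top[of 0]]\<close>)
  then show ?thesis
    using power_le_one[of "eq_bids.Hle y" m] by (simp add: eq_bids.Hle_def)
next
  case False
  then obtain z1 where z1: "0 \<le> z1" "y < eq_bid z1" by (auto simp: not_le)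
  define S where "S = {z. 0 \<le> z \<and> eq_bid z \<le> y}"
  define s where "s = Sup S"
  have S_le: "z \<le> z1" if "z \<in> S" for z
    using that z1 eq_bid_mono[of z1 z] by (force simp: S_def)
  have bdd: "bdd_above S" using S_le by (auto simp: bdd_above_def)
  have zero: "0 \<in> S" using assms(1) eq_bid_le[of 0] by (simp add: S_def)
  have s: "z \<le> s" if "z \<in> S" for z unfolding s_def using that bdd by (rule cSup_upper)
  have "eq_bids.Hle y \<le> F s"
    unfolding F_def eq_bids.Hle_def
  proof (rule finite_measure_mono_AE)
    show "AE z in D. z \<in> {z. eq_bid z \<le> y} \<longrightarrow> z \<in> {..s}"
      using AE_nonneg by eventually_elim (use s in \<open>auto simp: S_def\<close>)
  qed simp
  then have "eq_bids.Hle y ^ m \<le> G s"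
    unfolding G_def by (intro power_mono) (auto simp: eq_bids.Hle_def)
  also have "G s \<le> q"
  proof (cases "s = 0")
    case True
    then show ?thesis using le[of 0] zero by (simp add: S_def)
  next
    case False
    then have "0 < s" using s[OF zero] by simp
    have Gz: "G z \<le> q" if z: "0 < z" "z < s" for z
    proof -
      obtain z' where "z' \<in> S" "z < z'"
        using z(2) zero bdd unfolding s_def by (subst (asm) less_cSup_iff) auto
      then show ?thesis using le[of z] z eq_bid_mono[of z z'] by (auto simp: S_def)
    qed
    have "(G \<longlongrightarrow> G s) (at_left s)"
      using G_cont[of s] by (auto simp: isCont_def intro: tendsto_within_subset)
    then show ?thesis
      by (rule tendsto_upperbound)
         (use \<open>0 < s\<close> Gz in \<open>auto intro!: eventually_at_leftI[of 0 s]\<close>)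
  qed
  finally show ?thesis .
qed

text \<open>A bid \<open>y\<close> can win only against types bidding at most \<open>y\<close>, so
  it does no better than imitating such types, and \<open>eq_U_subgradient\<close> makes imitation
  unprofitable.\<close>

lemma eq_bid_best_response:
  assumes W_lower: "\<And>y. eq_bids.Hlt y ^ m \<le> W y"
    and W_le: "\<And>y. W y \<le> eq_bids.Hle y ^ m"
    and v: "0 \<le> v" and y: "0 \<le> y"
  shows "A y * W y * (v - y) \<le> A (eq_bid v) * W (eq_bid v) * (v - eq_bid v)"
proof -
  have W_nonneg: "0 \<le> W z" for z
    by (rule order_trans[OF _ W_lower[of z]]) (simp add: eq_bids.Hlt_def)
  have "A y * W y * (v - y) \<le> eq_U v"
  proof (cases "a \<le> y \<and> y < v")
    case False
    have "A y * W y * (v - y) \<le> 0"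
      using False A_simps(1)[of y] A_nonneg[of y] W_nonneg[of y]
      by (cases "a \<le> y") (auto simp: mult_nonneg_nonpos)
    then show ?thesis using eq_U_nonneg[OF v] by simp
  next
    case True
    define c where "c = A y * (v - y)"
    have c: "0 < c" using True by (simp add: c_def A_pos_iff)
    have "eq_bids.Hle y ^ m \<le> eq_U v / c"
    proof (rule Hle_le[OF y])
      fix z assume z: "0 \<le> z" "eq_bid z \<le> y"
      \<comment> \<open>\<open>y\<close> may be accepted by more exchanges than the bid of
        \<open>z\<close>. Moving \<open>z\<close> up to \<open>t\<close> or \<open>a\<close>
        restores \<open>A y * G z' = eq_x z'\<close>, and the new type still bids at most
        \<open>y\<close>.\<close>
      define z' where "z' = max z (if b \<le> y then t else a)"
      have z': "z \<le> z'" "0 \<le> z'" "eq_bid z' \<le> y"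
        using z True eq_bid_t eq_bid_le[OF a_nonneg] by (auto simp: z'_def max_def)
      have xz': "A y * G z' = eq_x z'"
      proof (cases "b \<le> y")
        case True
        then show ?thesis using A_simps a_le_t by (simp add: eq_x_def z'_def)
      next
        case False
        then have "z' < t" using eq_bid_high[of z'] z' by linarith
        then show ?thesis using A_simps False \<open>a \<le> y \<and> y < v\<close> by (simp add: eq_x_def z'_def)
      qed
      have "c * G z \<le> c * G z'" using c z' G_mono by simp
      also have "\<dots> = eq_x z' * (v - y)" by (simp add: c_def flip: xz')
      also have "\<dots> \<le> eq_x z' * (v - eq_bid z')"
        using z' eq_x_nonneg by (intro mult_left_mono) auto
      also have "\<dots> \<le> eq_U v"
      proof (cases "0 < eq_x z'")
        case True
        then show ?thesis
          using eq_x_eq_bid[OF True] eq_U_subgradient[OF z'(2) v] by (simp add: algebra_simps)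
      next
        case False
        then show ?thesis using eq_x_nonneg[of z'] eq_U_nonneg[OF v] by simp
      qed
      finally show "G z \<le> eq_U v / c" using c by (simp add: field_simps)
    qed
    then have "c * W y \<le> eq_U v"
      using W_le[of y] c by (simp add: field_simps) (smt (verit) mult_left_mono)
    then show ?thesis by (simp add: c_def mult_ac)
  qed
  also have "eq_U v \<le> A (eq_bid v) * W (eq_bid v) * (v - eq_bid v)"
  proof (cases "0 < eq_x v")
    case True
    have "eq_U v = A (eq_bid v) * G v * (v - eq_bid v)"
      using eq_x_eq_bid[OF True] eq_x_eq_A[OF True] by simp
    also have "\<dots> \<le> A (eq_bid v) * W (eq_bid v) * (v - eq_bid v)"
      using G_le_Hlt[OF True] W_lower[of "eq_bid v"] A_nonneg eq_bid_le[OF v]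
      by (intro mult_right_mono mult_left_mono) auto
    finally show ?thesis .
  next
    case False
    then have "v < a \<or> v = 0" using v eq_x_pos_iff[of v] by auto
    then have "eq_U v = 0" using eq_U_below[of v] a_nonneg by auto
    then show ?thesis using A_nonneg W_nonneg eq_bid_le[OF v] by simp
  qed
  finally show ?thesis .
qed

end

section \<open>Revenues\<close>

context two_step
begin

text \<open>Expected payment of type \<open>v\<close> to one exchange with reserve \<open>a\<close>;
  \<open>revenue_high\<close> is its counterpart for \<open>b\<close>. As in \<open>Rev\<close>, the
  weight of the exchange is not a factor.\<close>

definition revenue_low :: "real \<Rightarrow> real" where
  "revenue_low v = (if v < a then 0 else if v < t then v * G v - (I v - I a)
     else v * G v - \<alpha> * (I t - I a) - (I v - I t))"

definition revenue_high :: "real \<Rightarrow> real" where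
  "revenue_high v = (if v < t then 0 else v * G v - \<alpha> * (I t - I a) - (I v - I t))"

lemma revenue_measurable [measurable]:
  "revenue_low \<in> borel_measurable borel" "revenue_high \<in> borel_measurable borel"
  unfolding revenue_low_def[abs_def] revenue_high_def[abs_def] by measurable

text \<open>Supplies the existence premise under which \<open>bidding_selection\<close> says
  anything about \<open>\<sigma>\<close>.\<close>

lemma symmetric_BNE_eq_bid:
  fixes lam :: "'j::finite \<Rightarrow> real" and \<rho> :: "'j \<Rightarrow> real"
  assumes m: "CARD('i::finite) = Suc m"
    and A: "\<And>y. (\<Sum>j\<in>UNIV. lam j * of_bool (\<rho> j \<le> y)) = A y"
  shows "symmetric_BNE D (average_mechanism lam (\<lambda>j. FP (\<rho> j)) :: 'i mechanism) eq_bid"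
  unfolding symmetric_BNE_def interim_utility_average_FP A
  using eq_bid_measurable eq_bid_nonneg
    eq_bid_best_response[OF eq_bids.win_bounds(1)[OF m] eq_bids.win_le[OF m]]
  by auto

lemma equilibrium_if_symmetric_BNE:
  fixes lam :: "'j::finite \<Rightarrow> real" and \<rho> :: "'j \<Rightarrow> real" and i :: "'i::finite"
  assumes m: "CARD('i) = Suc m"
    and A: "\<And>y. (\<Sum>j\<in>UNIV. lam j * of_bool (\<rho> j \<le> y)) = A y"
    and BNE: "symmetric_BNE D (average_mechanism lam (\<lambda>j. FP (\<rho> j)) :: 'i mechanism) \<beta>"
  shows "equilibrium D f m a b t \<alpha> \<beta> (win D \<beta> i)"
proof -
  have "\<beta> \<in> borel_measurable borel" using BNE by (simp add: symmetric_BNE_def)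
  then interpret bid_model D \<beta> m by unfold_locales
  show ?thesis
    using BNE win_bounds[OF m, where i = i]
    unfolding symmetric_BNE_def interim_utility_average_FP A
    by unfold_locales auto
qed

lemma Rev_eq:
  fixes lam :: "'j::finite \<Rightarrow> real" and \<rho> :: "'j \<Rightarrow> real"
    and \<sigma> :: "('j \<Rightarrow> 'i::finite mechanism) \<Rightarrow> real \<Rightarrow> real"
  assumes m: "CARD('i) = Suc m"
    and A: "\<And>y. (\<Sum>j\<in>UNIV. lam j * of_bool (\<rho> j \<le> y)) = A y"
    and \<rho>: "\<And>j. 0 \<le> \<rho> j"
    and \<sigma>: "bidding_selection D lam FP_class \<sigma>"
    and finite: "finite_Rev D FP_class \<sigma>"
  shows "\<rho> j = a \<Longrightarrow> integrable D revenue_low \<and>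
      Rev D \<sigma> (\<lambda>j. FP (\<rho> j)) j = real CARD('i) * (\<integral>v. revenue_low v \<partial>D)"
    and "\<rho> j = b \<Longrightarrow> integrable D revenue_high \<and>
      Rev D \<sigma> (\<lambda>j. FP (\<rho> j)) j = real CARD('i) * (\<integral>v. revenue_high v \<partial>D)"
proof -
  define \<beta> where "\<beta> = \<sigma> (\<lambda>j. FP (\<rho> j))"
  have in_class: "\<forall>j. FP (\<rho> j) \<in> (FP_class :: 'i mechanism set)"
    using \<rho> by (auto simp: FP_class_def)
  have BNE: "symmetric_BNE D (average_mechanism lam (\<lambda>j. FP (\<rho> j)) :: 'i mechanism) \<beta>"
    using \<sigma>[unfolded bidding_selection_def, rule_format, of "\<lambda>j. FP (\<rho> j)"] in_class
      symmetric_BNE_eq_bid[OF m A]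
    unfolding \<beta>_def by blast
  have eq: "equilibrium D f m a b t \<alpha> \<beta> (win D \<beta> i)" for i :: 'i
    by (rule equilibrium_if_symmetric_BNE[OF m A BNE])
  have "\<beta> \<in> borel_measurable borel" "\<forall>v\<ge>0. 0 \<le> \<beta> v" using BNE by (auto simp: symmetric_BNE_def)
  then interpret bid_model D \<beta> m by unfold_locales
  have "AE v in D. 0 \<le> \<beta> v"
    using AE_nonneg by eventually_elim (use \<open>\<forall>v\<ge>0. 0 \<le> \<beta> v\<close> in auto)
  moreover have "integrable (\<Pi>\<^sub>M k\<in>UNIV. D) (total_payment (FP (\<rho> j) :: 'i mechanism) \<beta>)"
    using finite[unfolded finite_Rev_def, rule_format, of "\<lambda>j. FP (\<rho> j)" j] in_class
    by (simp add: \<beta>_def)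
  ultimately have
    int: "integrable D (\<lambda>v. of_bool (\<rho> j \<le> \<beta> v) * (win D \<beta> i (\<beta> v) * \<beta> v))" and
    Rev: "Rev D \<sigma> (\<lambda>j. FP (\<rho> j)) j =
      (\<Sum>i\<in>(UNIV :: 'i set). \<integral>v. of_bool (\<rho> j \<le> \<beta> v) * (win D \<beta> i (\<beta> v) * \<beta> v) \<partial>D)" for i :: 'i
    using integral_FP_total_payment[OF m, of "\<rho> j"] by (simp_all add: Rev_def \<beta>_def)
  have *: "integrable D R \<and> Rev D \<sigma> (\<lambda>j. FP (\<rho> j)) j = real CARD('i) * (\<integral>v. R v \<partial>D)"
    if AE: "\<And>i :: 'i. AE v in D. of_bool (\<rho> j \<le> \<beta> v) * (win D \<beta> i (\<beta> v) * \<beta> v) = R v"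
      and R [measurable]: "R \<in> borel_measurable borel" for R
  proof
    fix i :: 'i
    show "integrable D R"
      using int[of i] AE[of i] by (subst integrable_cong_AE[symmetric, OF _ _ AE[of i]]) auto
    have "(\<integral>v. of_bool (\<rho> j \<le> \<beta> v) * (win D \<beta> i (\<beta> v) * \<beta> v) \<partial>D) = (\<integral>v. R v \<partial>D)" for i :: 'i
      using int[of i] AE[of i] by (intro integral_cong_AE) auto
    then show "Rev D \<sigma> (\<lambda>j. FP (\<rho> j)) j = real CARD('i) * (\<integral>v. R v \<partial>D)"
      by (simp add: Rev)
  qed
  show "\<rho> j = a \<Longrightarrow> integrable D revenue_low \<and>
      Rev D \<sigma> (\<lambda>j. FP (\<rho> j)) j = real CARD('i) * (\<integral>v. revenue_low v \<partial>D)"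
    using equilibrium.AE_payment_a[OF eq]
    by (intro *) (simp_all add: revenue_low_def)
  show "\<rho> j = b \<Longrightarrow> integrable D revenue_high \<and>
      Rev D \<sigma> (\<lambda>j. FP (\<rho> j)) j = real CARD('i) * (\<integral>v. revenue_high v \<partial>D)"
    using equilibrium.AE_payment_b[OF eq]
    by (intro *) (simp_all add: revenue_high_def)
qed

end

section \<open>Comparison of revenues after a deviation\<close>

context value_model
begin

definition revenue :: "real \<Rightarrow> real \<Rightarrow> real" where
  "revenue r v = (if v < r then 0 else v * G v - (I v - I r))"

text \<open>Both sides of the threshold equation vanish; the weight 1/2 is an arbitrary split of the
  common reserve.\<close>

lemma two_step_uniform: "0 \<le> r \<Longrightarrow> two_step D f m r r r (1/2)"
  by unfold_locales auto

lemma Rev_uniform: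
  fixes lam :: "'j::finite \<Rightarrow> real"
    and \<sigma> :: "('j \<Rightarrow> 'i::finite mechanism) \<Rightarrow> real \<Rightarrow> real"
  assumes "CARD('i) = Suc m" "0 \<le> r" "(\<Sum>j\<in>UNIV. lam j) = 1"
    and "bidding_selection D lam FP_class \<sigma>" "finite_Rev D FP_class \<sigma>"
  shows "integrable D (revenue r)"
    and "Rev D \<sigma> (\<lambda>_. FP r) j = real CARD('i) * (\<integral>v. revenue r v \<partial>D)"
proof -
  interpret two_step D f m r r r "1/2" by (rule two_step_uniform[OF \<open>0 \<le> r\<close>])
  have "(\<Sum>j\<in>UNIV. lam j * of_bool (r \<le> y)) = A y" for y
    using assms(3) by (simp add: A_def flip: sum_distrib_right)
  moreover have "revenue_low = revenue r" by (auto simp: revenue_low_def revenue_def)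
  ultimately show "integrable D (revenue r)"
    "Rev D \<sigma> (\<lambda>_. FP r) j = real CARD('i) * (\<integral>v. revenue r v \<partial>D)"
    using Rev_eq(1)[OF assms(1) _ _ assms(4,5), of "\<lambda>_. r"] \<open>0 \<le> r\<close> by auto
qed

lemma prob_Ioc: "u \<le> v \<Longrightarrow> prob {u<..v} = F v - F u"
  by (simp add: F_diff)

(* To first order in r - a, the effect on bidders above t vanishes and the sales to values in
   (a, r) dominate the lower payments of values in (r, t). *)
lemma lower_reserve_gain:
  assumes "0 < r" "0 < \<theta>" "\<theta> < 1"
  obtains a t where "two_step D f m a r t \<theta>"
    and "integrable D (two_step.revenue_low D m a t \<theta>) \<Longrightarrow> integrable D (revenue r) \<Longrightarrow>
      (\<integral>v. revenue r v \<partial>D) < (\<integral>v. two_step.revenue_low D m a t \<theta> v \<partial>D)"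
proof -
  have "continuous_on {r/2..r} f"
    using assms by (intro continuous_on_subset[OF f_cont]) auto
  then obtain z where z: "z \<in> {r/2..r}" "\<And>x. x \<in> {r/2..r} \<Longrightarrow> f z \<le> f x"
    using continuous_attains_inf[of "{r/2..r}" f] assms by auto
  define \<mu> where "\<mu> = f z"
  have \<mu>: "0 < \<mu>" using z assms f_pos[of z] by (simp add: \<mu>_def)
  \<comment> \<open>Chosen so that \<open>\<theta> * (\<kappa> + 1) = \<kappa>\<close>: lowering the
    reserve by \<open>\<epsilon>\<close> leaves a threshold within
    \<open>\<kappa> * \<epsilon>\<close> above \<open>r\<close>.\<close>
  define \<kappa> where "\<kappa> = \<theta> / (1 - \<theta>)"
  have \<kappa>: "0 < \<kappa>" "\<kappa> * (1 - \<theta>) = \<theta>" using assms by (auto simp: \<kappa>_def)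
  define g where "g = r/2 * G (r/2)"
  have g: "0 < g" using assms G_pos[of "r/2"] by (simp add: g_def)
  \<comment> \<open>\<open>\<epsilon> * h t\<close> will bound the loss, and
    \<open>\<epsilon> * (g * \<mu>)\<close> the gain from below: \<open>\<mu>\<close> bounds the
    density near \<open>r\<close> and \<open>g\<close> the payments of new buyers.\<close>
  define h where "h t = G r * (F t - F r) + \<kappa> * (G t - G r)" for t
  have "isCont h r" unfolding h_def using F_cont G_cont by (intro continuous_intros) auto
  then have "(h \<longlongrightarrow> 0) (at r)" by (simp add: isCont_def h_def)
  then have "eventually (\<lambda>t. h t < g * \<mu>) (at r)"
    using g \<mu> by (intro order_tendstoD(2)[of h 0]) auto
  then obtain \<delta> where \<delta>: "0 < \<delta>" "\<And>t. t \<noteq> r \<Longrightarrow> dist t r < \<delta> \<Longrightarrow> h t < g * \<mu>"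
    by (auto simp: eventually_at)
  have h_less: "h t < g * \<mu>" if "r \<le> t" "t < r + \<delta>" for t
    using \<delta>(2)[of t] that g \<mu> by (cases "t = r") (auto simp: h_def dist_real_def)
  \<comment> \<open>The first bound keeps \<open>a\<close> where \<open>g\<close> and
    \<open>\<mu>\<close> are valid, the second keeps \<open>t\<close> where \<open>h\<close> is
    small.\<close>
  define \<epsilon> where "\<epsilon> = min (r/2) (\<delta> / (2 * \<kappa>))"
  have \<epsilon>: "0 < \<epsilon>" "\<epsilon> \<le> r/2" "\<kappa> * \<epsilon> < \<delta>"
  proof -
    have "\<kappa> * \<epsilon> \<le> \<kappa> * (\<delta> / (2 * \<kappa>))" unfolding \<epsilon>_def using \<kappa> by (intro mult_left_mono) auto
    also have "\<dots> < \<delta>" using \<kappa> \<delta> by simp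
    finally show "\<kappa> * \<epsilon> < \<delta>" .
  qed (use assms \<kappa> \<delta> in \<open>auto simp: \<epsilon>_def\<close>)
  define a where "a = r - \<epsilon>"
  have a: "0 < a" "r/2 \<le> a" "a < r" using \<epsilon> assms by (auto simp: a_def)
  define \<phi> where "\<phi> t = (t - r) * G t - \<theta> * (I t - I a)" for t
  define t1 where "t1 = r + \<kappa> * \<epsilon>"
  have t1: "r \<le> t1" using \<kappa> \<epsilon> by (simp add: t1_def)
  have "\<phi> r \<le> 0" using assms a I_mono[of a r] by (simp add: \<phi>_def)
  moreover have "0 \<le> \<phi> t1"
  proof -
    have "\<theta> * (I t1 - I a) \<le> \<theta> * (G t1 * (t1 - a))"
      using I_upper[of a t1] a t1 assms by (intro mult_left_mono) auto
    also have "\<dots> = G t1 * (\<theta> * (\<kappa> * \<epsilon> + \<epsilon>))" by (simp add: t1_def a_def algebra_simps)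
    also have "\<theta> * (\<kappa> * \<epsilon> + \<epsilon>) = \<kappa> * \<epsilon>"
    proof -
      have "\<theta> * (\<kappa> * \<epsilon> + \<epsilon>) = (\<theta> * \<kappa> + \<theta>) * \<epsilon>" by (simp add: algebra_simps)
      also have "\<theta> * \<kappa> + \<theta> = \<kappa>" using \<kappa>(2) by (simp add: algebra_simps)
      finally show ?thesis .
    qed
    finally show ?thesis by (simp add: \<phi>_def t1_def mult.commute)
  qed
  moreover have "continuous_on {r..t1} \<phi>"
    unfolding \<phi>_def using a t1
    by (intro continuous_intros G_continuous_on continuous_on_subset[OF I_cont[of t1]]) auto
  ultimately obtain t where t: "r \<le> t" "t \<le> t1" "\<phi> t = 0"
    using IVT'[of \<phi> r 0 t1] t1 by auto
  have step: "two_step D f m a r t \<theta>"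
    using a t assms by unfold_locales (auto simp: \<phi>_def)
  interpret two_step D f m a r t \<theta> by (rule step)
  have h_t: "h t < g * \<mu>" using t \<epsilon> by (intro h_less) (auto simp: t1_def)
  show thesis
  proof (rule that[OF step])
    assume int: "integrable D revenue_low" "integrable D (revenue r)"
    \<comment> \<open>A simple minorant of the change in revenue. Above \<open>t\<close> the change
      is \<open>I t - I r - (t - r) * G t\<close> by the threshold equation; its lower bound, the
      last term, is nonpositive and may be added everywhere.\<close>
    define e where "e v = a * G a * indicator {a<..r} v - \<epsilon> * G r * indicator {r<..t} v
      - (t - r) * (G t - G r)" for v :: real
    have slack: "0 \<le> (t - r) * (G t - G r)" "0 \<le> \<epsilon> * G r"
      using t G_mono[of r t] G_nonneg[of r] \<epsilon> by auto
    have e_le: "e v \<le> revenue_low v - revenue r v" if ne: "v \<noteq> a" "v \<noteq> r" "v \<noteq> t" for v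
    proof -
      consider "v < a" | "a < v" "v < r" | "r < v" "v < t" | "t < v"
        using ne by linarith
      then show ?thesis
      proof cases
        case 1
        then show ?thesis using a t slack by (simp add: e_def revenue_low_def revenue_def)
      next
        case 2
        have "a * G a \<le> a * G v" using 2 a G_mono[of a v] by simp
        also have "\<dots> = v * G v - G v * (v - a)" by (simp add: algebra_simps)
        also have "\<dots> \<le> v * G v - (I v - I a)" using I_upper[of a v] 2 a by simp
        finally show ?thesis
          using 2 t slack by (simp add: e_def revenue_low_def revenue_def)
      next
        case 3
        have "I r - I a \<le> \<epsilon> * G r" using I_upper[of a r] a by (simp add: a_def mult.commute)
        then show ?thesis
          using 3 a slack by (simp add: e_def revenue_low_def revenue_def)
      next
        case 4
        have "(t - r) * G r \<le> I t - I r" using I_lower[of r t] t assms by (simp add: mult.commute)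
        then show ?thesis
          using 4 a t threshold by (simp add: e_def revenue_low_def revenue_def right_diff_distrib)
      qed
    qed
    have "AE v in D. e v \<le> revenue_low v - revenue r v"
      using AE_neq[of a] AE_neq[of r] AE_neq[of t] by eventually_elim (rule e_le)
    moreover have ints: "integrable D (\<lambda>v. a * G a * indicator {a<..r} v)"
      "integrable D (\<lambda>v. \<epsilon> * G r * indicator {r<..t} v)" "integrable D (\<lambda>v. (t - r) * (G t - G r))"
      by (auto simp: emeasure_eq_measure)
    then have "integrable D e" unfolding e_def by (intro Bochner_Integration.integrable_diff)
    ultimately have "(\<integral>v. e v \<partial>D) \<le> (\<integral>v. revenue_low v - revenue r v \<partial>D)"
      using int by (intro integral_mono_AE) auto
    moreover have "(\<integral>v. e v \<partial>D) = a * G a * (F r - F a) - \<epsilon> * G r * (F t - F r) - (t - r) * (G t - G r)"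
      using ints prob_Ioc[of a r] prob_Ioc[of r t] a t prob_space
      by (simp add: e_def Bochner_Integration.integral_diff)
    moreover have "0 < a * G a * (F r - F a) - \<epsilon> * G r * (F t - F r) - (t - r) * (G t - G r)"
    proof -
      have "g \<le> a * G a"
        unfolding g_def using a assms G_mono[of "r/2" a] G_nonneg[of "r/2"] by (intro mult_mono) auto
      moreover have "\<mu> * \<epsilon> \<le> F r - F a"
        using F_diff_ge[of a r \<mu>] z a \<mu> by (auto simp: \<mu>_def a_def)
      ultimately have "g * (\<mu> * \<epsilon>) \<le> a * G a * (F r - F a)"
        using g \<mu> \<epsilon> by (intro mult_mono) auto
      moreover have "(t - r) * (G t - G r) \<le> \<kappa> * \<epsilon> * (G t - G r)"
        using t G_mono[of r t] by (intro mult_right_mono) (auto simp: t1_def)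
      moreover have "\<epsilon> * h t < \<epsilon> * (g * \<mu>)" using h_t \<epsilon> by simp
      ultimately show ?thesis by (simp add: h_def algebra_simps)
    qed
    ultimately have "0 < (\<integral>v. revenue_low v - revenue r v \<partial>D)" by linarith
    then show "(\<integral>v. revenue r v \<partial>D) < (\<integral>v. revenue_low v \<partial>D)"
      using int by (simp add: Bochner_Integration.integral_diff)
  qed
qed

text \<open>As \<open>t\<close> tends to 0, \<open>t * K\<close> vanishes while the right side tends
  to \<open>\<theta>\<close>; one bound \<open>K\<close> on \<open>[0, 1]\<close> serves all small
  \<open>t\<close>. The inequality weighs the loss from raising a reserve against the gain.\<close>

lemma small_threshold:
  assumes "0 < \<theta>"
  obtains t K where "0 < t" "\<And>v. 0 \<le> v \<Longrightarrow> v \<le> t \<Longrightarrow> f v \<le> K" "t * K < \<theta> * (1 - F t)"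
proof -
  have "continuous_on {0..1} f" by (rule continuous_on_subset[OF f_cont]) auto
  then obtain z where z: "z \<in> {0..1}" "\<And>x. x \<in> {0..1} \<Longrightarrow> f x \<le> f z"
    using continuous_attains_sup[of "{0..1}" f] by auto
  have "isCont (\<lambda>t. \<theta> * (1 - F t) - t * f z) 0" using F_cont by (intro continuous_intros) auto
  then have "((\<lambda>t. \<theta> * (1 - F t) - t * f z) \<longlongrightarrow> \<theta>) (at_right 0)"
    by (auto simp: isCont_def F_0 intro: tendsto_within_subset)
  then have "eventually (\<lambda>t. 0 < \<theta> * (1 - F t) - t * f z) (at_right 0)"
    using assms by (intro order_tendstoD(1)) auto
  moreover have "eventually (\<lambda>t. t \<in> {0<..<1::real}) (at_right 0)"
    by (rule eventually_at_right_real) simp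
  ultimately have "eventually (\<lambda>t. 0 < \<theta> * (1 - F t) - t * f z \<and> t \<in> {0<..<1}) (at_right 0)"
    by (rule eventually_conj)
  then obtain t where "0 < \<theta> * (1 - F t) - t * f z" "t \<in> {0<..<1}"
    using eventually_happens by force
  then show thesis using z by (intro that[of t "f z"]) auto
qed

text \<open>The density bound replaces the value distribution by \<open>K\<close> times Lebesgue
  measure, for which the integral is \<open>I t\<close>.\<close>

lemma integral_G_le:
  assumes "0 \<le> t" "\<And>v. 0 \<le> v \<Longrightarrow> v \<le> t \<Longrightarrow> f v \<le> K"
  shows "(\<integral>v. indicator {0..t} v * G v \<partial>D) \<le> K * I t"
proof -
  have cont: "set_integrable lborel {0..t} h" if "continuous_on {0..t} h" for h :: "real \<Rightarrow> real"
    using that by (rule borel_integrable_atLeastAtMost')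
  have "(\<integral>v. indicator {0..t} v * G v \<partial>D) = (\<integral>v. f v *\<^sub>R (indicator {0..t} v * G v) \<partial>lborel)"
    by (subst D_density, rule integral_density) (auto simp: f_nonneg)
  also have "\<dots> = (LINT v:{0..t}|lborel. f v * G v)"
    unfolding set_lebesgue_integral_def by (intro Bochner_Integration.integral_cong) auto
  also have "\<dots> \<le> (LINT v:{0..t}|lborel. K * G v)"
    using assms G_nonneg
    by (intro set_integral_mono cont continuous_intros G_continuous_on continuous_on_subset[OF f_cont])
       (auto intro!: mult_right_mono)
  also have "\<dots> = K * (LINT v:{0..t}|lborel. G v)" by simp
  also have "(LINT v:{0..t}|lborel. G v) = I t"
    unfolding I_def by (intro set_borel_integral_eq_integral cont G_continuous_on)
  finally show ?thesis .
qed

(* Losing the values below t costs at most t * K * I t, where K bounds the density. Values below t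
   now win only with weight 1 - theta, so the rent of every value above t falls by theta * I t. *)
lemma raise_reserve_gain:
  assumes "0 < \<theta>" "\<theta> < 1"
  obtains b t where "two_step D f m 0 b t (1 - \<theta>)"
    and "integrable D (two_step.revenue_high D m 0 t (1 - \<theta>)) \<Longrightarrow> integrable D (revenue 0) \<Longrightarrow>
      (\<integral>v. revenue 0 v \<partial>D) < (\<integral>v. two_step.revenue_high D m 0 t (1 - \<theta>) v \<partial>D)"
proof -
  obtain t K where t: "0 < t" and K: "\<And>v. 0 \<le> v \<Longrightarrow> v \<le> t \<Longrightarrow> f v \<le> K"
    and small: "t * K < \<theta> * (1 - F t)"
    using small_threshold[OF assms(1)] by blast
  \<comment> \<open>Solves the threshold equation for \<open>b\<close>;
    \<open>I t \<le> t * G t\<close> keeps it nonnegative.\<close>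
  define b where "b = t - (1 - \<theta>) * I t / G t"
  have G: "0 < G t" and I: "0 < I t" using t G_pos I_pos by auto
  have "(1 - \<theta>) * I t \<le> 1 * (G t * t)"
    using assms I I_upper[of 0 t] t by (intro mult_mono) (auto simp: I_0)
  then have b: "0 \<le> b" "b \<le> t" using G I assms by (auto simp: b_def field_simps)
  have step: "two_step D f m 0 b t (1 - \<theta>)"
    using b G assms by unfold_locales (auto simp: b_def I_0)
  interpret two_step D f m 0 b t "1 - \<theta>" by (rule step)
  show thesis
  proof (rule that[OF step])
    assume int: "integrable D revenue_high" "integrable D (revenue 0)"
    define e where "e v = \<theta> * I t * indicator {t<..} v - t * (indicator {0..t} v * G v)" for v :: real
    have e_le: "e v \<le> revenue_high v - revenue 0 v" if ne: "v \<noteq> t" for v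
    proof -
      consider "v < 0" | "0 \<le> v" "v < t" | "t < v" using ne by linarith
      then show ?thesis
      proof cases
        case 2
        have "v * G v - I v \<le> t * G v"
          using 2 I_mono[of 0 v] mult_right_mono[of v t "G v"] G_nonneg[of v] I_0 by simp
        then show ?thesis using 2 by (simp add: e_def revenue_high_def revenue_def I_0)
      qed (use t in \<open>auto simp: e_def revenue_high_def revenue_def I_0 algebra_simps\<close>)
    qed
    have "AE v in D. e v \<le> revenue_high v - revenue 0 v"
      using AE_neq[of t] by eventually_elim (rule e_le)
    moreover have ints: "integrable D (\<lambda>v. \<theta> * I t * indicator {t<..} v)"
      "integrable D (\<lambda>v. t * (indicator {0..t} v * G v))"
    proof -
      have "integrable D (\<lambda>v. indicator {0..t} v * G v)"
        by (rule integrable_const_bound[where B = 1])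
           (auto simp: indicator_def G_nonneg G_le_1)
      then show "integrable D (\<lambda>v. t * (indicator {0..t} v * G v))"
        by (rule integrable_mult_right)
    qed (auto simp: emeasure_eq_measure)
    then have "integrable D e" unfolding e_def by (rule Bochner_Integration.integrable_diff)
    ultimately have "(\<integral>v. e v \<partial>D) \<le> (\<integral>v. revenue_high v - revenue 0 v \<partial>D)"
      using int by (intro integral_mono_AE) auto
    moreover have "(\<integral>v. e v \<partial>D) = \<theta> * I t * (1 - F t) - t * (\<integral>v. indicator {0..t} v * G v \<partial>D)"
    proof -
      have "prob {t<..} = 1 - F t"
        using prob_compl[of "{..t}"] by (simp add: F_def Compl_atMost flip: Compl_eq_Diff_UNIV)
      then show ?thesis
        unfolding e_def by (simp add: Bochner_Integration.integral_diff[OF ints])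
    qed
    moreover have "0 < \<theta> * I t * (1 - F t) - t * (\<integral>v. indicator {0..t} v * G v \<partial>D)"
    proof -
      have "t * (\<integral>v. indicator {0..t} v * G v \<partial>D) \<le> t * (K * I t)"
        using t K by (intro mult_left_mono integral_G_le) auto
      also have "\<dots> = t * K * I t" by simp
      also have "\<dots> < \<theta> * (1 - F t) * I t" using small I by (rule mult_strict_right_mono)
      finally show ?thesis by (simp add: mult_ac)
    qed
    ultimately have "0 < (\<integral>v. revenue_high v - revenue 0 v \<partial>D)" by linarith
    then show "(\<integral>v. revenue 0 v \<partial>D) < (\<integral>v. revenue_high v \<partial>D)"
      using int by (simp add: Bochner_Integration.integral_diff)
  qed
qed

end

theorem theorem4p3:
  fixes D :: "real measure" and f :: "real \<Rightarrow> real"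
    and lam :: "'j::finite \<Rightarrow> real"
    and \<sigma> :: "('j \<Rightarrow> 'i::finite mechanism) \<Rightarrow> real \<Rightarrow> real"
    and r :: real
  assumes "CARD('i) \<ge> 2" and "CARD('j) \<ge> 2"
    and "value_distribution D f"
    and "\<forall>j. lam j > 0" and "(\<Sum>j\<in>UNIV. lam j) = 1"
    and "bidding_selection D lam FP_class \<sigma>"
    and "finite_Rev D FP_class \<sigma>"
    and "r \<ge> 0"
  shows "\<not> exchange_Nash FP_class (Rev D \<sigma>) (\<lambda>_. FP r)"
proof
  assume Nash: "exchange_Nash FP_class (Rev D \<sigma>) (\<lambda>_. FP r)"
  define m where "m = CARD('i) - 1"
  have m: "CARD('i) = Suc m" "1 \<le> m" using assms(1) by (auto simp: m_def)
  interpret value_model D f m by unfold_locales (use assms(3) m in auto)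
  \<comment> \<open>Any exchange can be the deviator; the presence of another one makes its weight
    less than 1.\<close>
  fix j0 :: 'j
  define \<theta> where "\<theta> = lam j0"
  have others: "(\<Sum>j\<in>UNIV - {j0}. lam j) = 1 - \<theta>"
    using assms(5) by (simp add: \<theta>_def sum.remove[of UNIV j0])
  have "UNIV - {j0} \<noteq> {}"
    using assms(2) card_mono[of "{j0}" UNIV] by auto
  then have "0 < (\<Sum>j\<in>UNIV - {j0}. lam j)" using assms(4) by (intro sum_pos) auto
  then have \<theta>: "0 < \<theta>" "\<theta> < 1" using others assms(4) by (auto simp: \<theta>_def)
  define \<rho> where "\<rho> s j = (if j = j0 then s else r)" for s j
  have weights: "(\<Sum>j\<in>UNIV. lam j * of_bool (\<rho> s j \<le> y)) =
      \<theta> * of_bool (s \<le> y) + (1 - \<theta>) * of_bool (r \<le> y)" for s y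
    by (subst sum.remove[of _ j0])
       (simp_all add: \<rho>_def \<theta>_def others[unfolded \<theta>_def, symmetric] sum_distrib_right del: sum_mult_of_bool_eq)
  have dev: "(\<lambda>_. FP r)(j0 := FP s) = (\<lambda>j. FP (\<rho> s j))" for s
    by (auto simp: \<rho>_def)
  have no_gain: "Rev D \<sigma> (\<lambda>j. FP (\<rho> s j)) j0 \<le> Rev D \<sigma> (\<lambda>_. FP r) j0" if "0 \<le> s" for s
    using Nash that unfolding exchange_Nash_def dev[symmetric] FP_class_def by blast
  note base = Rev_uniform[OF m(1) assms(8,5,6,7)]
  have gain: False
    if "0 \<le> s" "Rev D \<sigma> (\<lambda>j. FP (\<rho> s j)) j0 = real CARD('i) * R" "(\<integral>v. revenue r v \<partial>D) < R" for s R
    using no_gain[OF that(1)] that(2,3) base(2)[of j0] m(1) by (simp add: mult_le_cancel_left)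
  show False
  proof (cases "r = 0")
    case False
    then obtain a t where step: "two_step D f m a r t \<theta>"
      and less: "integrable D (two_step.revenue_low D m a t \<theta>) \<Longrightarrow> integrable D (revenue r) \<Longrightarrow>
        (\<integral>v. revenue r v \<partial>D) < (\<integral>v. two_step.revenue_low D m a t \<theta> v \<partial>D)"
      using lower_reserve_gain[OF _ \<theta>] assms(8) by (metis less_eq_real_def)
    interpret two_step D f m a r t \<theta> by (rule step)
    have "integrable D revenue_low \<and>
        Rev D \<sigma> (\<lambda>j. FP (\<rho> a j)) j0 = real CARD('i) * (\<integral>v. revenue_low v \<partial>D)"
      by (rule Rev_eq(1)[OF m(1) _ _ assms(6,7)], simp only: weights A_def)
         (use a_nonneg assms(8) in \<open>auto simp: \<rho>_def\<close>)
    then show False using gain[OF a_nonneg] less base(1) by blast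
  next
    case True
    obtain b t where step: "two_step D f m 0 b t (1 - \<theta>)"
      and less: "integrable D (two_step.revenue_high D m 0 t (1 - \<theta>)) \<Longrightarrow> integrable D (revenue 0) \<Longrightarrow>
        (\<integral>v. revenue 0 v \<partial>D) < (\<integral>v. two_step.revenue_high D m 0 t (1 - \<theta>) v \<partial>D)"
      using raise_reserve_gain[OF \<theta>] by blast
    \<comment> \<open>The deviator now has the higher reserve, so the weight of the low reserve is
      that of the others.\<close>
    interpret two_step D f m 0 b t "1 - \<theta>" by (rule step)
    have "integrable D revenue_high \<and>
        Rev D \<sigma> (\<lambda>j. FP (\<rho> b j)) j0 = real CARD('i) * (\<integral>v. revenue_high v \<partial>D)"
      by (rule Rev_eq(2)[OF m(1) _ _ assms(6,7)], simp only: weights A_def True)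
         (use a_le_b True in \<open>auto simp: \<rho>_def\<close>)
    then show False using gain[OF a_le_b] less base(1) True by blast
  qed
qed

end
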